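(* Let $0\le c<2$ and let $\bar u_c:(-\infty,0]\to[0,1)$ be the asymptotic spreading profile of speed $c$. Consider the operator $$\mathcal{L}p := p_{zz}+c\,p_z+(1-2\bar u_c(z))\,p$$ on $L^2((-\infty,0))$ (complex-valued functions) with boundary conditions $p_z(-\infty)=0$ and $p(0)=0$. Then $\bar u_c$ is spectrally stable: the essential spectrum of $\mathcal{L}$ is contained in the open left half plane $\{\lambda\in\mathbb{C}:\operatorname{Re}\lambda<0\}$, and $\mathcal{L}$ has no point spectrum with $\operatorname{Re}\lambda\ge 0$.
   Context: For $0\le c<2$, $\bar u_c$ denotes the unique solution on $(-\infty,0]$ of $u_{zz}+c\,u_z+u(1-u)=0$, $u_z(-\infty)=0$, $u(0)=0$, that is positive on $(-\infty,0)$, decreasing in $z$, and tends to $1$ as $z\to-\infty$; equivalently, $(\bar u_c,\bar u_c')$ is the part in the fourth quadrant ($u\ge0$, $v\le 0$) of the unstable manifold of the saddle $(1,0)$ of the system $u_z=v$, $v_z=-cv-u(1-u)$, parametrized so that $u=0$ at $z=0$. The existence and uniqueness of $\bar u_c$ is a known fact. The operator $\mathcal{L}$ is regarded as a closed, densely defined operator on $L^2((-\infty,0))$ with domain $\{p\in H^2((-\infty,0)): p(0)=0\}$ (functions in this domain automatically satisfy $p_z(-\infty)=0$). The essential spectrum of $\mathcal{L}$ is the set of $\lambda\in\mathbb{C}$ such that $\mathcal{L}-\lambda$ is either not Fredholm, or Fredholm with nonzero index. The point spectrum of $\mathcal{L}$ is the set of $\lambda\in\mathbb{C}$ such that $\mathcal{L}-\lambda$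 is Fredholm of index zero but not invertible. *)

theory Defs
  imports "HOL-Analysis.Analysis"
begin

section \<open>The Hilbert space of complex-valued square-integrable functions on the negative half-line\<close>

abbreviation halfline :: "real measure"
  where "halfline \<equiv> lebesgue_on {..<0}"

definition square_int :: "(real \<Rightarrow> complex) \<Rightarrow> bool"
  where "square_int f \<longleftrightarrow>
    f \<in> borel_measurable halfline \<and> integrable halfline (\<lambda>z. (cmod (f z))\<^sup>2)"

lemma square_int_zero: "square_int (\<lambda>z. 0)"
  by (simp add: square_int_def)

lemma square_int_dominated:
  assumes "square_int f" "g \<in> borel_measurable halfline"
    and "\<And>z. cmod (g z) \<le> K * cmod (f z)"
  shows "square_int g"
proof -
  have "integrable halfline (\<lambda>z. K\<^sup>2 * (cmod (f z))\<^sup>2)"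
    using assms(1) by (simp add: square_int_def)
  then have "integrable halfline (\<lambda>z. (cmod (g z))\<^sup>2)"
  proof (rule Bochner_Integration.integrable_bound)
    show "(\<lambda>z. (cmod (g z))\<^sup>2) \<in> borel_measurable halfline"
      using assms(2) by measurable
    show "AE z in halfline. norm ((cmod (g z))\<^sup>2) \<le> norm (K\<^sup>2 * (cmod (f z))\<^sup>2)"
    proof (rule AE_I2)
      fix z
      have "(cmod (g z))\<^sup>2 \<le> (K * cmod (f z))\<^sup>2"
        using assms(3)[of z] by (intro power_mono) auto
      then show "norm ((cmod (g z))\<^sup>2) \<le> norm (K\<^sup>2 * (cmod (f z))\<^sup>2)"
        by (simp add: power_mult_distrib)
    qed
  qed
  then show ?thesis
    using assms(2) by (simp add: square_int_def)
qed

lemma square_int_cmult: "square_int f \<Longrightarrow> square_int (\<lambda>z. k * f z)"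
  by (rule square_int_dominated[where K = "cmod k" and f = f])
    (auto simp: square_int_def norm_mult)

lemma square_int_scaleR: "square_int f \<Longrightarrow> square_int (\<lambda>z. k *\<^sub>R f z)"
  using square_int_cmult[of f "complex_of_real k"] by (simp add: scaleR_conv_of_real)

lemma square_int_uminus: "square_int f \<Longrightarrow> square_int (\<lambda>z. - f z)"
  using square_int_cmult[of f "-1"] by simp

lemma square_int_add:
  assumes "square_int f" "square_int g"
  shows "square_int (\<lambda>z. f z + g z)"
proof -
  have m: "f \<in> borel_measurable halfline" "g \<in> borel_measurable halfline"
    using assms by (auto simp: square_int_def)
  have "integrable halfline (\<lambda>z. 2 * (cmod (f z))\<^sup>2 + 2 * (cmod (g z))\<^sup>2)"
    using assms by (auto simp: square_int_def)
  then have "integrable halfline (\<lambda>z. (cmod (f z + g z))\<^sup>2)"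
  proof (rule Bochner_Integration.integrable_bound)
    show "(\<lambda>z. (cmod (f z + g z))\<^sup>2) \<in> borel_measurable halfline"
      using m by measurable
    show "AE z in halfline. norm ((cmod (f z + g z))\<^sup>2)
        \<le> norm (2 * (cmod (f z))\<^sup>2 + 2 * (cmod (g z))\<^sup>2)"
    proof (rule AE_I2)
      fix z
      have "(cmod (f z + g z))\<^sup>2 \<le> (cmod (f z) + cmod (g z))\<^sup>2"
        by (intro power_mono norm_triangle_ineq) auto
      also have "\<dots> \<le> 2 * (cmod (f z))\<^sup>2 + 2 * (cmod (g z))\<^sup>2"
        using sum_squares_bound[of "cmod (f z)" "cmod (g z)"] by (simp add: power2_sum)
      finally show "norm ((cmod (f z + g z))\<^sup>2)
          \<le> norm (2 * (cmod (f z))\<^sup>2 + 2 * (cmod (g z))\<^sup>2)"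
        by simp
    qed
  qed
  then show ?thesis
    using m by (auto simp: square_int_def)
qed

lemma square_int_diff: "square_int f \<Longrightarrow> square_int g \<Longrightarrow> square_int (\<lambda>z. f z - g z)"
  using square_int_add[OF _ square_int_uminus, of f g] by simp

lemma square_int_integrable_inner:
  assumes "square_int f" "square_int g"
  shows "integrable halfline (\<lambda>z. f z \<bullet> g z)"
proof -
  have m: "f \<in> borel_measurable halfline" "g \<in> borel_measurable halfline"
    using assms by (auto simp: square_int_def)
  have "integrable halfline (\<lambda>z. (cmod (f z))\<^sup>2 + (cmod (g z))\<^sup>2)"
    using assms by (auto simp: square_int_def)
  then show ?thesis
  proof (rule Bochner_Integration.integrable_bound)
    show "(\<lambda>z. f z \<bullet> g z) \<in> borel_measurable halfline"
      using m by measurable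
    show "AE z in halfline. norm (f z \<bullet> g z) \<le> norm ((cmod (f z))\<^sup>2 + (cmod (g z))\<^sup>2)"
    proof (rule AE_I2)
      fix z
      have "\<bar>f z \<bullet> g z\<bar> \<le> cmod (f z) * cmod (g z)"
        by (rule Cauchy_Schwarz_ineq2)
      also have "\<dots> \<le> (cmod (f z))\<^sup>2 + (cmod (g z))\<^sup>2"
        using sum_squares_bound[of "cmod (f z)" "cmod (g z)"]
          mult_nonneg_nonneg[of "cmod (f z)" "cmod (g z)", OF norm_ge_zero norm_ge_zero]
        by linarith
      finally show "norm (f z \<bullet> g z) \<le> norm ((cmod (f z))\<^sup>2 + (cmod (g z))\<^sup>2)"
        by simp
    qed
  qed
qed

definition l2_rel :: "(real \<Rightarrow> complex) \<Rightarrow> (real \<Rightarrow> complex) \<Rightarrow> bool"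
  where "l2_rel f g \<longleftrightarrow> square_int f \<and> square_int g \<and> (AE z in halfline. f z = g z)"

quotient_type l2 = "real \<Rightarrow> complex" / partial: l2_rel
proof (rule part_equivpI)
  show "\<exists>f. l2_rel f f"
    using square_int_zero by (auto simp: l2_rel_def)
  show "symp l2_rel"
    by (auto simp: symp_def l2_rel_def elim: AE_mp)
  show "transp l2_rel"
  proof (rule transpI)
    fix f g h
    assume fg: "l2_rel f g" and gh: "l2_rel g h"
    have "AE z in halfline. f z = g z" "AE z in halfline. g z = h z"
      using fg gh by (simp_all add: l2_rel_def)
    then have "AE z in halfline. f z = h z"
      by eventually_elim simp
    then show "l2_rel f h"
      using fg gh by (simp add: l2_rel_def)
  qed
qed

lemma square_int_rep: "square_int (rep_l2 p)"
  using Quotient3_rep_reflp[OF Quotient3_l2, of p] by (simp add: l2_rel_def)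

lemma rep_abs_l2:
  assumes "square_int f"
  shows "AE z in halfline. rep_l2 (abs_l2 f) z = f z"
  using rep_abs_rsp_left[OF Quotient3_l2, of f f] assms by (simp add: l2_rel_def)

lemma l2_eq_iff: "p = q \<longleftrightarrow> (AE z in halfline. rep_l2 p z = rep_l2 q z)"
  using Quotient3_rel_rep[OF Quotient3_l2, of p q] square_int_rep by (auto simp: l2_rel_def)

instantiation l2 :: ab_group_add
begin

lift_definition zero_l2 :: l2 is "\<lambda>z. 0"
  by (simp add: l2_rel_def square_int_zero)

lift_definition plus_l2 :: "l2 \<Rightarrow> l2 \<Rightarrow> l2" is "\<lambda>f g z. f z + g z"
  by (auto simp: l2_rel_def square_int_add)

lift_definition uminus_l2 :: "l2 \<Rightarrow> l2" is "\<lambda>f z. - f z"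
  by (auto simp: l2_rel_def square_int_uminus)

lift_definition minus_l2 :: "l2 \<Rightarrow> l2 \<Rightarrow> l2" is "\<lambda>f g z. f z - g z"
  by (auto simp: l2_rel_def square_int_diff)

instance
  by (standard; transfer)
    (auto simp: l2_rel_def square_int_add square_int_diff square_int_uminus square_int_zero
      algebra_simps)

end

lift_definition scaleC :: "complex \<Rightarrow> l2 \<Rightarrow> l2"  (infixr "*\<^sub>C" 75) is "\<lambda>k f z. k * f z"
  by (auto simp: l2_rel_def square_int_cmult)

instantiation l2 :: real_vector
begin

lift_definition scaleR_l2 :: "real \<Rightarrow> l2 \<Rightarrow> l2" is "\<lambda>k f z. k *\<^sub>R f z"
  by (auto simp: l2_rel_def square_int_scaleR)

instance
proof
  fix p q :: l2 and a b :: real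
  show "a *\<^sub>R (p + q) = a *\<^sub>R p + a *\<^sub>R q"
    by transfer (auto simp: l2_rel_def algebra_simps square_int_add square_int_scaleR)
  show "(a + b) *\<^sub>R p = a *\<^sub>R p + b *\<^sub>R p"
    by transfer (auto simp: l2_rel_def algebra_simps square_int_add square_int_scaleR)
  show "a *\<^sub>R b *\<^sub>R p = (a * b) *\<^sub>R p"
    by transfer (auto simp: l2_rel_def square_int_scaleR)
  show "1 *\<^sub>R p = p"
    by transfer (auto simp: l2_rel_def)
qed

end

text \<open>
  The Hilbert space norm is that of the underlying real inner product
  \<open>Re \<integral> f(z) cnj (g(z)) dz\<close>, since \<open>w \<bullet> w' = Re (w * cnj w')\<close> on complex numbers.
\<close>

instantiation l2 :: real_inner
begin

lift_definition inner_l2 :: "l2 \<Rightarrow> l2 \<Rightarrow> real" is "\<lambda>f g. LINT z|halfline. f z \<bullet> g z"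
proof -
  fix f f' g g'
  assume A: "l2_rel f f'" "l2_rel g g'"
  then have m: "f \<in> borel_measurable halfline" "g \<in> borel_measurable halfline"
      "f' \<in> borel_measurable halfline" "g' \<in> borel_measurable halfline"
    by (auto simp: l2_rel_def square_int_def)
  show "(LINT z|halfline. f z \<bullet> g z) = (LINT z|halfline. f' z \<bullet> g' z)"
  proof (rule integral_cong_AE)
    show "(\<lambda>z. f z \<bullet> g z) \<in> borel_measurable halfline"
      "(\<lambda>z. f' z \<bullet> g' z) \<in> borel_measurable halfline"
      using m by measurable
    have "AE z in halfline. f z = f' z" "AE z in halfline. g z = g' z"
      using A by (auto simp: l2_rel_def)
    then show "AE z in halfline. f z \<bullet> g z = f' z \<bullet> g' z"
      by eventually_elim simp
  qed
qed

definition norm_l2 :: "l2 \<Rightarrow> real" where "norm_l2 p = sqrt (p \<bullet> p)"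
definition sgn_l2 :: "l2 \<Rightarrow> l2" where "sgn_l2 p = p /\<^sub>R norm p"
definition dist_l2 :: "l2 \<Rightarrow> l2 \<Rightarrow> real" where "dist_l2 p q = norm (p - q)"
definition uniformity_l2 :: "(l2 \<times> l2) filter"
  where "uniformity_l2 = (INF e\<in>{0<..}. principal {(p, q). dist p q < e})"
definition open_l2 :: "l2 set \<Rightarrow> bool"
  where "open_l2 U \<longleftrightarrow> (\<forall>p\<in>U. \<forall>\<^sub>F (p', q) in uniformity. p' = p \<longrightarrow> q \<in> U)"

instance
proof
  fix p q r :: l2 and a :: real
  show "dist p q = norm (p - q)" by (fact dist_l2_def)
  show "sgn p = p /\<^sub>R norm p" by (fact sgn_l2_def)
  show "(uniformity :: (l2 \<times> l2) filter) = (INF e\<in>{0<..}. principal {(p, q). dist p q < e})"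
    by (fact uniformity_l2_def)
  show "open U \<longleftrightarrow> (\<forall>p\<in>U. \<forall>\<^sub>F (p', q) in uniformity. p' = p \<longrightarrow> q \<in> U)" for U :: "l2 set"
    by (fact open_l2_def)
  show "norm p = sqrt (p \<bullet> p)" by (fact norm_l2_def)
  show "p \<bullet> q = q \<bullet> p"
    by transfer (simp add: inner_commute)
  show "(p + q) \<bullet> r = p \<bullet> r + q \<bullet> r"
    by transfer (simp add: inner_add_left l2_rel_def square_int_integrable_inner)
  show "(a *\<^sub>R p) \<bullet> q = a * (p \<bullet> q)"
    by transfer simp
  show "0 \<le> p \<bullet> p"
    by transfer simp
  show "p \<bullet> p = 0 \<longleftrightarrow> p = 0"
  proof transfer
    fix f assume f: "l2_rel f f"
    then have "square_int f" by (simp add: l2_rel_def)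
    then have "(LINT z|halfline. f z \<bullet> f z) = 0 \<longleftrightarrow> (AE z in halfline. f z \<bullet> f z = 0)"
      by (intro integral_nonneg_eq_0_iff_AE) (auto intro: square_int_integrable_inner)
    then show "(LINT z|halfline. f z \<bullet> f z) = 0 \<longleftrightarrow> l2_rel f (\<lambda>z. 0)"
      using \<open>square_int f\<close> by (simp add: l2_rel_def square_int_zero)
  qed
qed

end

lemma norm_l2_eq: "norm p = sqrt (LINT z|halfline. (cmod (rep_l2 p z))\<^sup>2)"
  by (simp add: norm_l2_def inner_l2.rep_eq dot_square_norm)

global_interpretation cvs: vector_space scaleC
proof
  fix a b :: complex and p q :: l2
  show "a *\<^sub>C (p + q) = a *\<^sub>C p + a *\<^sub>C q"
    by transfer (auto simp: l2_rel_def algebra_simps square_int_add square_int_cmult)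
  show "(a + b) *\<^sub>C p = a *\<^sub>C p + b *\<^sub>C p"
    by transfer (auto simp: l2_rel_def algebra_simps square_int_add square_int_cmult)
  show "a *\<^sub>C b *\<^sub>C p = (a * b) *\<^sub>C p"
    by transfer (auto simp: l2_rel_def mult.assoc intro: square_int_cmult[of _ "_ * _"]
      dest: square_int_cmult[where k = "a * b"] simp flip: mult.assoc)
  show "1 *\<^sub>C p = p"
    by transfer (auto simp: l2_rel_def)
qed

text \<open>Multiplication by a bounded measurable function; for other multipliers the value is junk.\<close>

definition mult_l2 :: "(real \<Rightarrow> real) \<Rightarrow> l2 \<Rightarrow> l2"
  where "mult_l2 a p = abs_l2 (\<lambda>z. of_real (a z) * rep_l2 p z)"

lemma rep_mult_l2:
  assumes "a \<in> borel_measurable halfline" "\<And>z. z < 0 \<Longrightarrow> \<bar>a z\<bar> \<le> K"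
  shows "AE z in halfline. rep_l2 (mult_l2 a p) z = of_real (a z) * rep_l2 p z"
proof -
  let ?g = "\<lambda>z. if z < 0 then of_real (a z) * rep_l2 p z else 0"
  have m: "(\<lambda>z. of_real (a z) * rep_l2 p z) \<in> borel_measurable halfline"
  proof -
    have "rep_l2 p \<in> borel_measurable halfline"
      using square_int_rep[of p] by (simp add: square_int_def)
    then show ?thesis
      using assms(1) by measurable
  qed
  have g: "?g \<in> borel_measurable halfline"
    using m by (subst measurable_cong[where g = "\<lambda>z. of_real (a z) * rep_l2 p z"]) auto
  have "square_int ?g"
  proof (rule square_int_dominated[OF square_int_rep[of p] g, where K = "\<bar>K\<bar>"])
    show "cmod (?g z) \<le> \<bar>K\<bar> * cmod (rep_l2 p z)" for z
      using assms(2)[of z] by (auto simp: norm_mult intro!: mult_right_mono)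
  qed
  moreover have "integrable halfline (\<lambda>z. (cmod (?g z))\<^sup>2) \<longleftrightarrow>
      integrable halfline (\<lambda>z. (cmod (of_real (a z) * rep_l2 p z))\<^sup>2)"
    by (rule Bochner_Integration.integrable_cong) auto
  ultimately have "square_int (\<lambda>z. of_real (a z) * rep_l2 p z)"
    using m by (simp add: square_int_def)
  then show ?thesis
    unfolding mult_l2_def by (rule rep_abs_l2)
qed

section \<open>Sobolev space\<close>

text \<open>
  On an interval, testing against compactly supported \<open>C\<^sup>1\<close> functions yields the same weak
  derivatives as testing against \<open>C\<^sup>\<infinity>\<close> ones (see Brezis, Functional Analysis, Sobolev Spaces and
  Partial Differential Equations, Section 8.2, which uses the former as the definition).
\<close>

definition test_function :: "(real \<Rightarrow> real) \<Rightarrow> (real \<Rightarrow> real) \<Rightarrow> bool"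
  where "test_function \<phi> \<phi>' \<longleftrightarrow>
    (\<forall>z. (\<phi> has_real_derivative \<phi>' z) (at z)) \<and> continuous_on UNIV \<phi>' \<and>
    (\<exists>K. compact K \<and> K \<subseteq> {..<0} \<and> (\<forall>z. z \<notin> K \<longrightarrow> \<phi> z = 0))"

definition weak_deriv :: "l2 \<Rightarrow> l2 \<Rightarrow> bool"
  where "weak_deriv p q \<longleftrightarrow>
    (\<forall>\<phi> \<phi>'. test_function \<phi> \<phi>' \<longrightarrow>
      (LINT z|halfline. \<phi>' z *\<^sub>R rep_l2 p z) = - (LINT z|halfline. \<phi> z *\<^sub>R rep_l2 q z))"

definition wderiv :: "l2 \<Rightarrow> l2"
  where "wderiv p = (THE q. weak_deriv p q)"

definition H2 :: "l2 set"
  where "H2 = {p. \<exists>q r. weak_deriv p q \<and> weak_deriv q r}"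

text \<open>Vanishing at 0 refers to the representative that is continuous up to the boundary.\<close>

definition vanishes_at_0 :: "l2 \<Rightarrow> bool"
  where "vanishes_at_0 p \<longleftrightarrow>
    (\<exists>f. continuous_on {..0} f \<and> (AE z in halfline. rep_l2 p z = f z) \<and> f 0 = 0)"

section \<open>Fredholm operators and spectra\<close>

text \<open>
  An unbounded linear operator is given by its domain \<open>D\<close> and a function \<open>A\<close>, of which only the
  values on \<open>D\<close> matter.
\<close>

definition ker_on :: "l2 set \<Rightarrow> (l2 \<Rightarrow> l2) \<Rightarrow> l2 set"
  where "ker_on D A = {p \<in> D. A p = 0}"

definition finite_dim :: "l2 set \<Rightarrow> bool"
  where "finite_dim V \<longleftrightarrow> (\<exists>B. finite B \<and> V \<subseteq> cvs.span B)"

definition finite_codim :: "l2 set \<Rightarrow> bool"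
  where "finite_codim R \<longleftrightarrow> (\<exists>B. finite B \<and> cvs.span (R \<union> B) = UNIV)"

text \<open>The dimension of the quotient space by a subspace \<open>R\<close> of finite codimension.\<close>

definition codim :: "l2 set \<Rightarrow> nat"
  where "codim R = (LEAST n. \<exists>B. finite B \<and> card B = n \<and> cvs.span (R \<union> B) = UNIV)"

definition fredholm :: "l2 set \<Rightarrow> (l2 \<Rightarrow> l2) \<Rightarrow> bool"
  where "fredholm D A \<longleftrightarrow> finite_dim (ker_on D A) \<and> closed (A ` D) \<and> finite_codim (A ` D)"

definition fredholm_index :: "l2 set \<Rightarrow> (l2 \<Rightarrow> l2) \<Rightarrow> int"
  where "fredholm_index D A = int (cvs.dim (ker_on D A)) - int (codim (A ` D))"

definition invertible_op :: "l2 set \<Rightarrow> (l2 \<Rightarrow> l2) \<Rightarrow> bool"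
  where "invertible_op D A \<longleftrightarrow>
    bij_betw A D UNIV \<and> (\<exists>K. \<forall>g. norm (inv_into D A g) \<le> K * norm g)"

definition shifted :: "(l2 \<Rightarrow> l2) \<Rightarrow> complex \<Rightarrow> l2 \<Rightarrow> l2"
  where "shifted A \<mu> p = A p - \<mu> *\<^sub>C p"

definition essential_spectrum :: "l2 set \<Rightarrow> (l2 \<Rightarrow> l2) \<Rightarrow> complex set"
  where "essential_spectrum D A =
    {\<mu>. \<not> fredholm D (shifted A \<mu>) \<or>
         fredholm D (shifted A \<mu>) \<and> fredholm_index D (shifted A \<mu>) \<noteq> 0}"

definition point_spectrum :: "l2 set \<Rightarrow> (l2 \<Rightarrow> l2) \<Rightarrow> complex set"
  where "point_spectrum D A =
    {\<mu>. fredholm D (shifted A \<mu>) \<and> fredholm_index D (shifted A \<mu>) = 0 \<and>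
         \<not> invertible_op D (shifted A \<mu>)}"

section \<open>The profile and the linearized operator\<close>

text \<open>
  Monotonicity is required in the weak sense; together with the other conditions it implies
  strict monotonicity. Values of \<open>u\<close> on positive arguments are irrelevant.
\<close>

definition spreading_profile :: "real \<Rightarrow> (real \<Rightarrow> real) \<Rightarrow> bool"
  where "spreading_profile c u \<longleftrightarrow>
    (\<exists>v. (\<forall>z\<le>0. (u has_real_derivative v z) (at z within {..0})) \<and>
         (\<forall>z\<le>0. \<exists>w. (v has_real_derivative w) (at z within {..0}) \<and>
                     w + c * v z + u z * (1 - u z) = 0) \<and>
         (v \<longlongrightarrow> 0) at_bot) \<and>
    u 0 = 0 \<and> (\<forall>z<0. 0 < u z) \<and> u ` {..0} \<subseteq> {0..<1} \<and>
    antimono_on {..0} u \<and> (u \<longlongrightarrow> 1) at_bot"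

definition dom_L :: "l2 set"
  where "dom_L = {p \<in> H2. vanishes_at_0 p}"

definition op_L :: "real \<Rightarrow> (real \<Rightarrow> real) \<Rightarrow> l2 \<Rightarrow> l2"
  where "op_L c u p =
    wderiv (wderiv p) + c *\<^sub>R wderiv p + mult_l2 (\<lambda>z. 1 - 2 * u z) p"

end

theory Submission
  imports Defs
begin

text \<open>
  Why the theorem holds. For every \<open>\<mu>\<close> with \<open>Re \<mu> \<ge> 0\<close> the operator \<open>L - \<mu>\<close> is a bijection of its domain
  onto \<open>L\<^sup>2\<close> with bounded inverse, hence Fredholm of index 0 and invertible, so that \<open>\<mu>\<close> lies in neither
  part of the spectrum.

  Injectivity and the resolvent bound come from a weighted energy identity. The exponential weight
  \<open>e\<^bsup>cz\<^esup>\<close> makes \<open>L\<close> symmetric but degenerates at \<open>-\<infinity>\<close>; the weight \<open>w = \<epsilon> + e\<^bsup>cz\<^esup>\<close> is equivalent to the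
  constant weight, and since \<open>w'' = c w'\<close> the quadratic form of \<open>-L\<close> in the \<open>w\<close>-inner product is still
  \<open>\<integral> w (|p'|\<^sup>2 + (2u - 1) |p|\<^sup>2)\<close>. Its \<open>e\<^bsup>cz\<^esup>\<close> part is nonnegative because \<open>\<psi> = u - u'\<close> is a positive
  supersolution: \<open>L u' = 0\<close> (translation) and \<open>L u = -u\<^sup>2\<close> give \<open>L \<psi> = -u\<^sup>2\<close>, so completing the square with
  \<open>\<phi> = \<psi>'/\<psi>\<close> leaves the strictly positive density \<open>e\<^bsup>cz\<^esup> u\<^sup>2/\<psi>\<close> on \<open>z < 0\<close>
  (\<open>profile_riccati_supersolution\<close>). In the \<open>\<epsilon>\<close> part, \<open>2u - 1\<close> is close to 1 near \<open>-\<infinity>\<close>, the boundary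
  condition \<open>p(0) = 0\<close> provides positivity near 0, and what remains lives on a compact set, where
  it is absorbed for small \<open>\<epsilon>\<close> (\<open>energy_multiplier\<close>). Altogether the form dominates
  \<open>\<delta> |p|\<^sup>2\<close>, uniformly for all potentials \<open>P\<close> with \<open>Re P \<ge> 2u - 1\<close> in place of \<open>2u - 1\<close>
  (\<open>energy_estimate\<close>).

  Surjectivity follows by the method of continuity along the segment from the model operator
  \<open>T = \<partial>\<^sup>2 + c \<partial> - 1\<close> to \<open>L - \<mu>\<close>: all potentials on this segment satisfy \<open>Re P \<ge> 2u - 1\<close>, so the energy
  estimate bounds all the inverses by one constant, and solvability propagates by Banach's fixed point theorem
  (\<open>method_of_continuity\<close>, \<open>complete_l2\<close>). The model operator is a product of two first order operators with
  roots of opposite sign and is inverted by variation of constants (\<open>model_operator_surj\<close>).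

  To apply this calculus to elements of \<open>H\<^sup>2\<close>, weak derivatives are identified with
  derivatives of absolutely continuous functions (\<open>weak_deriv_imp_primitive\<close>).
\<close>

section \<open>Absolutely continuous functions on the half-line\<close>

text \<open>
  The replacement for differentiation almost everywhere in the product rule below: an increment that is
  of lower order than that of a fixed \<open>M\<close>, uniformly in the position, sums up to zero over
  a fine partition.
\<close>

lemma constant_if_small_increments:
  fixes H :: "real \<Rightarrow> 'a::real_normed_vector" and M :: "real \<Rightarrow> real"
  assumes "a \<le> b"
    and small: "\<And>e. e > 0 \<Longrightarrow> \<exists>d>0. \<forall>x y. a \<le> x \<and> x \<le> y \<and> y \<le> b \<and> y - x < d \<longrightarrow>
      norm (H y - H x) \<le> e * (M y - M x)"
  shows "H b = H a"
proof -
  have bound: "norm (H b - H a) \<le> e * (M b - M a)" if e: "e > 0" for e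
  proof -
    obtain d where d: "d > 0"
      "\<And>x y. a \<le> x \<Longrightarrow> x \<le> y \<Longrightarrow> y \<le> b \<Longrightarrow> y - x < d \<Longrightarrow> norm (H y - H x) \<le> e * (M y - M x)"
      using small[OF e] by blast
    obtain n :: nat where n: "(b - a) / d < real n" "n > 0"
      by (metis reals_Archimedean2 d(1) dual_order.strict_trans gr0I of_nat_0 of_nat_0_less_iff
          zero_less_one divide_nonneg_pos \<open>a \<le> b\<close> diff_ge_0_iff_ge not_less)
    define x where "x k = a + real k * ((b - a) / real n)" for k
    have x0: "x 0 = a" and xn: "x n = b"
      using n by (auto simp: x_def)
    have step: "x (Suc k) - x k = (b - a) / real n" for k
      using n by (simp add: x_def field_simps)
    have mono: "x k \<le> x (Suc k)" for k
      using step[of k] \<open>a \<le> b\<close> by (smt (verit) divide_nonneg_nonneg of_nat_0_le_iff)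
    then have incr: "incseq x"
      by (rule incseq_SucI)
    have sm: "(b - a) / real n < d"
      using n d(1) by (simp add: field_simps)
    have "norm (H (x (Suc k)) - H (x k)) \<le> e * (M (x (Suc k)) - M (x k))" if "k < n" for k
    proof (rule d(2))
      show "a \<le> x k" using incseqD[OF incr, of 0 k] x0 by simp
      show "x (Suc k) \<le> b" using incseqD[OF incr, of "Suc k" n] xn that by simp
    qed (use mono step sm in auto)
    then have "(\<Sum>k<n. norm (H (x (Suc k)) - H (x k))) \<le> (\<Sum>k<n. e * (M (x (Suc k)) - M (x k)))"
      by (intro sum_mono) auto
    also have "\<dots> = e * (M b - M a)"
      using sum_lessThan_telescope[of "\<lambda>k. M (x k)" n] x0 xn by (simp flip: sum_distrib_left)
    finally show ?thesis
      using norm_sum[of "\<lambda>k. H (x (Suc k)) - H (x k)" "{..<n}"]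
        sum_lessThan_telescope[of "\<lambda>k. H (x k)" n] x0 xn by simp
  qed
  have "norm (H b - H a) \<le> 0"
  proof (rule field_le_epsilon)
    fix \<eta> :: real assume \<eta>: "\<eta> > 0"
    define K where "K = \<bar>M b - M a\<bar> + 1"
    have K: "K > 0" "M b - M a \<le> K" by (auto simp: K_def)
    have "norm (H b - H a) \<le> \<eta> / K * (M b - M a)"
      using bound[of "\<eta> / K"] \<eta> K by simp
    also have "\<dots> \<le> \<eta> / K * K"
      using \<eta> K by (intro mult_left_mono) auto
    finally show "norm (H b - H a) \<le> 0 + \<eta>" using K by simp
  qed
  then show ?thesis by simp
qed

text \<open>
  Local absolute continuity of \<open>f\<close> on \<open>(-\<infinity>,0]\<close> with derivative \<open>g\<close> almost everywhere, expressed through the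
  fundamental theorem of calculus. The interval is closed at 0 so that boundary values there make sense.
\<close>

definition primitive :: "(real \<Rightarrow> 'a::euclidean_space) \<Rightarrow> (real \<Rightarrow> 'a) \<Rightarrow> bool"
  where "primitive f g \<longleftrightarrow> (\<forall>a b. a \<le> b \<longrightarrow> b \<le> 0 \<longrightarrow>
    g absolutely_integrable_on {a..b} \<and> f b - f a = integral {a..b} g)"

lemma primitive_abs_int: "primitive f g \<Longrightarrow> b \<le> 0 \<Longrightarrow> g absolutely_integrable_on {a..b}"
  by (cases "a \<le> b") (auto simp: primitive_def)

lemma primitive_int: "primitive f g \<Longrightarrow> b \<le> 0 \<Longrightarrow> g integrable_on {a..b}"
  using primitive_abs_int set_lebesgue_integral_eq_integral(1) by blast

lemma primitive_diff: "primitive f g \<Longrightarrow> a \<le> b \<Longrightarrow> b \<le> 0 \<Longrightarrow> f b - f a = integral {a..b} g"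
  by (auto simp: primitive_def)

lemma continuous_on_halfline:
  fixes f :: "real \<Rightarrow> 'a::topological_space"
  assumes "\<And>a. a < 0 \<Longrightarrow> continuous_on {a..0} f"
  shows "continuous_on {..0} f"
  unfolding continuous_on_eq_continuous_within
proof
  fix z :: real assume z: "z \<in> {..0}"
  have "continuous_on {z - 1..0} f" using assms z by auto
  then have "continuous (at z within {z - 1..0}) f"
    using z by (auto simp: continuous_on_eq_continuous_within)
  moreover have "at z within {z - 1..0} = at z within {..0}"
    by (rule at_within_nhd[of _ "{z - 1<..}"]) auto
  ultimately show "continuous (at z within {..0}) f" by simp
qed

lemma primitive_continuous:
  assumes "primitive f g"
  shows "continuous_on {..0} f"
proof (rule continuous_on_halfline)
  fix a :: real assume "a < 0"
  have "continuous_on {a..0} (\<lambda>x. f a + integral {a..x} g)"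
    using indefinite_integral_continuous_1[OF primitive_int[OF assms order_refl, of a]]
    by (intro continuous_intros)
  then show "continuous_on {a..0} f"
    by (rule continuous_on_eq) (use primitive_diff[OF assms] in \<open>auto simp: algebra_simps\<close>)
qed

lemma primitive_continuous_Icc: "primitive f g \<Longrightarrow> b \<le> 0 \<Longrightarrow> continuous_on {a..b} f"
  by (rule continuous_on_subset[OF primitive_continuous]) auto

lemma primitive_add:
  assumes "primitive f g" "primitive F G"
  shows "primitive (\<lambda>z. f z + F z) (\<lambda>z. g z + G z)"
  unfolding primitive_def
proof (intro allI impI conjI)
  fix a b :: real assume ab: "a \<le> b" "b \<le> 0"
  show "(\<lambda>z. g z + G z) absolutely_integrable_on {a..b}"
    using primitive_abs_int[OF assms(1) ab(2)] primitive_abs_int[OF assms(2) ab(2)]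
    by (rule set_integral_add(1))
  show "f b + F b - (f a + F a) = integral {a..b} (\<lambda>z. g z + G z)"
    using primitive_diff[OF assms(1) ab] primitive_diff[OF assms(2) ab]
      Henstock_Kurzweil_Integration.integral_add[OF primitive_int[OF assms(1) ab(2), of a]
        primitive_int[OF assms(2) ab(2), of a]]
    by (simp add: algebra_simps)
qed

lemma primitive_linear:
  assumes "primitive f g" "bounded_linear h"
  shows "primitive (\<lambda>z. h (f z)) (\<lambda>z. h (g z))"
  unfolding primitive_def
proof (intro allI impI conjI)
  fix a b :: real assume ab: "a \<le> b" "b \<le> 0"
  show "(\<lambda>z. h (g z)) absolutely_integrable_on {a..b}"
    using absolutely_integrable_linear[OF primitive_abs_int[OF assms(1) ab(2)] assms(2)]
    by (simp add: o_def)
  show "h (f b) - h (f a) = integral {a..b} (\<lambda>z. h (g z))"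
    using primitive_diff[OF assms(1) ab] integral_linear[OF primitive_int[OF assms(1) ab(2), of a] assms(2)]
    by (simp add: o_def linear_diff[OF bounded_linear.linear, OF assms(2), symmetric])
qed

lemma primitive_cong_AE:
  assumes "primitive f g" "AE z in halfline. g z = g' z"
  shows "primitive f g'"
proof -
  have "AE z in lebesgue. z < 0 \<longrightarrow> g z = g' z"
    using assms(2) by (simp add: AE_restrict_space_iff)
  then obtain N where N: "N \<in> null_sets lebesgue" "\<And>z. z \<notin> N \<Longrightarrow> z < 0 \<longrightarrow> g z = g' z"
    by (rule AE_E3) auto
  then have neg: "negligible (insert 0 N)"
    by (simp add: negligible_iff_null_sets[symmetric])
  show ?thesis
    unfolding primitive_def
  proof (intro allI impI conjI)
    fix a b :: real assume ab: "a \<le> b" "b \<le> 0"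
    show "g' absolutely_integrable_on {a..b}"
      by (rule absolutely_integrable_spike[OF primitive_abs_int[OF assms(1) ab(2)] neg])
        (use ab N(2) in \<open>force simp: less_le\<close>)
    show "f b - f a = integral {a..b} g'"
      unfolding primitive_diff[OF assms(1) ab]
      by (rule integral_spike[OF neg]) (use ab N(2) in \<open>force simp: less_le\<close>)
  qed
qed

lemma primitive_of_deriv:
  fixes f :: "real \<Rightarrow> 'a::euclidean_space"
  assumes der: "\<And>z. z \<le> 0 \<Longrightarrow> (f has_vector_derivative g z) (at z within {..0})"
    and cont: "continuous_on {..0} g"
  shows "primitive f g"
  unfolding primitive_def
proof (intro allI impI conjI)
  fix a b :: real assume ab: "a \<le> b" "b \<le> 0"
  show "g absolutely_integrable_on {a..b}"
    by (rule absolutely_integrable_continuous_real, rule continuous_on_subset[OF cont])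
      (use ab in auto)
  have "(g has_integral f b - f a) {a..b}"
    by (rule fundamental_theorem_of_calculus[OF ab(1)])
      (use ab der in \<open>auto intro!: has_vector_derivative_within_subset[OF der]\<close>)
  then show "f b - f a = integral {a..b} g" by (simp add: integral_unique)
qed

text \<open>
  The product rule. On \<open>[x,y]\<close> the defect of the rule is
  \<open>\<integral> h (f y - f s) (G s) + h (g s) (F x - F s) ds\<close>, which is at most \<open>e \<integral> |g| + |G|\<close> by uniform continuity once
  \<open>y - x\<close> is small.
\<close>

lemma primitive_bilinear:
  fixes f :: "real \<Rightarrow> 'a::euclidean_space" and F :: "real \<Rightarrow> 'b::euclidean_space"
    and h :: "'a \<Rightarrow> 'b \<Rightarrow> 'c::euclidean_space"
  assumes f: "primitive f g" and F: "primitive F G" and h: "bounded_bilinear h"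
  shows "primitive (\<lambda>z. h (f z) (F z)) (\<lambda>z. h (f z) (G z) + h (g z) (F z))"
proof -
  interpret bounded_bilinear h by (rule h)
  have bil: "bilinear h" using h bilinear_conv_bounded_bilinear by blast
  have bil': "bilinear (\<lambda>x y. h y x)" using bil by (auto simp: bilinear_def)
  obtain K where K: "K > 0" "\<And>x y. norm (h x y) \<le> norm x * norm y * K"
    using pos_bounded by blast
  have int1: "(\<lambda>z. h (f z) (G z)) absolutely_integrable_on {a..b}" if "b \<le> 0" for a b
  proof (rule absolutely_integrable_bounded_measurable_product[OF bil _ _ _ primitive_abs_int[OF F that]])
    show "f \<in> borel_measurable (lebesgue_on {a..b})"
      by (rule continuous_imp_measurable_on_sets_lebesgue[OF primitive_continuous_Icc[OF f that]]) auto
    show "bounded (f ` {a..b})"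
      by (rule compact_imp_bounded[OF compact_continuous_image[OF primitive_continuous_Icc[OF f that]]]) auto
  qed auto
  have int2: "(\<lambda>z. h (g z) (F z)) absolutely_integrable_on {a..b}" if "b \<le> 0" for a b
  proof (rule absolutely_integrable_bounded_measurable_product[OF bil' _ _ _ primitive_abs_int[OF f that]])
    show "F \<in> borel_measurable (lebesgue_on {a..b})"
      by (rule continuous_imp_measurable_on_sets_lebesgue[OF primitive_continuous_Icc[OF F that]]) auto
    show "bounded (F ` {a..b})"
      by (rule compact_imp_bounded[OF compact_continuous_image[OF primitive_continuous_Icc[OF F that]]]) auto
  qed auto
  have int: "(\<lambda>z. h (f z) (G z) + h (g z) (F z)) absolutely_integrable_on {a..b}" if "b \<le> 0" for a b
    using set_integral_add(1)[OF int1 int2] that by blast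
  show ?thesis
    unfolding primitive_def
  proof (intro allI impI conjI)
    fix a b :: real assume ab: "a \<le> b" "b \<le> 0"
    show "(\<lambda>z. h (f z) (G z) + h (g z) (F z)) absolutely_integrable_on {a..b}"
      by (rule int[OF ab(2)])
    let ?k = "\<lambda>z. h (f z) (G z) + h (g z) (F z)"
    define H where "H x = h (f x) (F x) - integral {a..x} ?k" for x
    define M where "M x = integral {a..x} (\<lambda>s. norm (g s) + norm (G s))" for x
    have mi: "(\<lambda>s. norm (g s) + norm (G s)) integrable_on {x..y}" if "y \<le> 0" for x y
      using absolutely_integrable_norm[OF primitive_abs_int[OF f that]]
        absolutely_integrable_norm[OF primitive_abs_int[OF F that]]
      by (intro Henstock_Kurzweil_Integration.integrable_add)
        (auto simp: o_def dest: set_lebesgue_integral_eq_integral(1))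
    have ki: "?k integrable_on {x..y}" if "y \<le> 0" for x y
      using int[OF that] set_lebesgue_integral_eq_integral(1) by blast
    have "H b = H a"
    proof (rule constant_if_small_increments[OF ab(1), where M = M])
      fix e :: real assume e: "e > 0"
      have uc: "uniformly_continuous_on {a..b} f" "uniformly_continuous_on {a..b} F"
        using primitive_continuous_Icc[OF f ab(2)] primitive_continuous_Icc[OF F ab(2)]
        by (auto intro: compact_uniformly_continuous)
      have eK: "e / K > 0" using e K by simp
      obtain d1 where d1: "d1 > 0" "\<And>x y. x \<in> {a..b} \<Longrightarrow> y \<in> {a..b} \<Longrightarrow> dist y x < d1 \<Longrightarrow> dist (f y) (f x) < e / K"
        using uc(1) eK unfolding uniformly_continuous_on_def by metis
      obtain d2 where d2: "d2 > 0" "\<And>x y. x \<in> {a..b} \<Longrightarrow> y \<in> {a..b} \<Longrightarrow> dist y x < d2 \<Longrightarrow> dist (F y) (F x) < e / K"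
        using uc(2) eK unfolding uniformly_continuous_on_def by metis
      show "\<exists>d>0. \<forall>x y. a \<le> x \<and> x \<le> y \<and> y \<le> b \<and> y - x < d \<longrightarrow> norm (H y - H x) \<le> e * (M y - M x)"
      proof (intro exI[of _ "min d1 d2"] conjI allI impI)
        show "min d1 d2 > 0" using d1 d2 by simp
        fix x y assume A: "a \<le> x \<and> x \<le> y \<and> y \<le> b \<and> y - x < min d1 d2"
        then have xy: "x \<le> y" "y \<le> 0" "x \<le> 0" using ab by auto
        have split: "integral {a..y} ?k = integral {a..x} ?k + integral {x..y} ?k"
          using Henstock_Kurzweil_Integration.integral_combine[of a x y ?k] A ki[OF xy(2)] by simp
        have splitM: "M y - M x = integral {x..y} (\<lambda>s. norm (g s) + norm (G s))"
          using Henstock_Kurzweil_Integration.integral_combine[of a x y "\<lambda>s. norm (g s) + norm (G s)"]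
            A mi[OF xy(2)] by (simp add: M_def)
        have I1: "(\<lambda>s. h (f y) (G s)) integrable_on {x..y}" "integral {x..y} (\<lambda>s. h (f y) (G s)) = h (f y) (F y - F x)"
          using integrable_linear[OF primitive_int[OF F xy(2), of x] bounded_linear_right[of "f y"]]
            integral_linear[OF primitive_int[OF F xy(2), of x] bounded_linear_right[of "f y"]]
            primitive_diff[OF F xy(1,2)] by (auto simp: o_def)
        have I2: "(\<lambda>s. h (g s) (F x)) integrable_on {x..y}" "integral {x..y} (\<lambda>s. h (g s) (F x)) = h (f y - f x) (F x)"
          using integrable_linear[OF primitive_int[OF f xy(2), of x] bounded_linear_left[of "F x"]]
            integral_linear[OF primitive_int[OF f xy(2), of x] bounded_linear_left[of "F x"]]
            primitive_diff[OF f xy(1,2)] by (auto simp: o_def)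
        have "H y - H x = h (f y) (F y - F x) + h (f y - f x) (F x) - integral {x..y} ?k"
          unfolding H_def split by (simp add: diff_left diff_right)
        also have "\<dots> = integral {x..y} (\<lambda>s. h (f y) (G s) + h (g s) (F x)) - integral {x..y} ?k"
          using I1 I2 by (simp add: Henstock_Kurzweil_Integration.integral_add)
        also have "\<dots> = integral {x..y} (\<lambda>s. h (f y) (G s) + h (g s) (F x) - ?k s)"
          by (rule Henstock_Kurzweil_Integration.integral_diff[OF
                Henstock_Kurzweil_Integration.integrable_add[OF I1(1) I2(1)] ki[OF xy(2)], symmetric])
        finally have eq: "H y - H x = integral {x..y} (\<lambda>s. h (f y) (G s) + h (g s) (F x) - ?k s)" .
        have "norm (H y - H x) \<le> integral {x..y} (\<lambda>s. e * (norm (g s) + norm (G s)))"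
          unfolding eq
        proof (rule integral_norm_bound_integral)
          show "(\<lambda>s. h (f y) (G s) + h (g s) (F x) - ?k s) integrable_on {x..y}"
            by (rule Henstock_Kurzweil_Integration.integrable_diff[OF
                  Henstock_Kurzweil_Integration.integrable_add[OF I1(1) I2(1)] ki[OF xy(2)]])
          show "(\<lambda>s. e * (norm (g s) + norm (G s))) integrable_on {x..y}"
            using mi[OF xy(2)] by (rule integrable_on_mult_right)
          fix s assume s: "s \<in> {x..y}"
          have "norm (f y - f s) \<le> e / K" "norm (F x - F s) \<le> e / K"
            using d1(2)[of s y] d2(2)[of s x] s A by (auto simp: dist_norm less_imp_le)
          then have "norm (f y - f s) * norm (G s) * K \<le> e / K * norm (G s) * K"
            "norm (g s) * norm (F x - F s) * K \<le> norm (g s) * (e / K) * K"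
            using K(1) by (metis less_imp_le mult_right_mono mult_left_mono norm_ge_zero)+
          then have "norm (h (f y - f s) (G s)) \<le> e / K * norm (G s) * K"
            "norm (h (g s) (F x - F s)) \<le> norm (g s) * (e / K) * K"
            using K(2) order_trans by blast+
          then have "norm (h (f y - f s) (G s)) \<le> e * norm (G s)" "norm (h (g s) (F x - F s)) \<le> e * norm (g s)"
            using K(1) by (auto simp: mult.commute)
          moreover have "h (f y) (G s) + h (g s) (F x) - ?k s = h (f y - f s) (G s) + h (g s) (F x - F s)"
            by (simp add: diff_left diff_right)
          ultimately show "norm (h (f y) (G s) + h (g s) (F x) - ?k s) \<le> e * (norm (g s) + norm (G s))"
            using norm_triangle_ineq[of "h (f y - f s) (G s)" "h (g s) (F x - F s)"]
            by (simp add: algebra_simps)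
        qed
        then show "norm (H y - H x) \<le> e * (M y - M x)"
          by (simp add: splitM)
      qed
    qed
    then show "h (f b) (F b) - h (f a) (F a) = integral {a..b} ?k"
      by (simp add: H_def algebra_simps)
  qed
qed


section \<open>Weak derivatives and absolute continuity\<close>

lemma halfline_integrable_iff:
  fixes F :: "real \<Rightarrow> 'a::euclidean_space"
  shows "integrable halfline F \<longleftrightarrow> F absolutely_integrable_on {..0}"
proof -
  have "F absolutely_integrable_on {..<0} \<longleftrightarrow> F absolutely_integrable_on {..0}"
    by (rule absolutely_integrable_spike_set_eq) (auto intro: negligible_subset[of "{0}"])
  then show ?thesis
    by (simp add: integrable_restrict_space set_integrable_def)
qed

lemma halfline_integral_eq:
  fixes F :: "real \<Rightarrow> 'a::euclidean_space"
  assumes "integrable halfline F"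
  shows "(LINT z|halfline. F z) = integral {..0} F"
proof -
  have "(LINT z|halfline. F z) = integral {..<0} F"
    by (rule lebesgue_integral_eq_integral[OF assms]) auto
  also have "\<dots> = integral {..0} F"
    by (rule integral_spike_set) (auto intro: negligible_subset[of "{0}"])
  finally show ?thesis .
qed

lemma truncated_halfline_integral:
  fixes F :: "real \<Rightarrow> 'a::euclidean_space"
  assumes F: "F absolutely_integrable_on {A..0}" and z: "\<And>z. z < A \<Longrightarrow> F z = 0"
  shows "integrable halfline F" "(LINT z|halfline. F z) = integral {A..0} F"
proof -
  have "F absolutely_integrable_on {..0}"
    by (rule absolutely_integrable_spike_set[OF F]) (use z in \<open>auto intro: negligible_subset[of "{}"]\<close>)
  then show i: "integrable halfline F" by (simp add: halfline_integrable_iff)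
  show "(LINT z|halfline. F z) = integral {A..0} F"
    unfolding halfline_integral_eq[OF i]
    by (rule integral_spike_set) (use z in \<open>auto intro: negligible_subset[of "{}"]\<close>)
qed

lemma square_int_abs_int:
  assumes "square_int f" "b \<le> 0"
  shows "f absolutely_integrable_on {a..b}"
proof -
  have "(\<lambda>z. (cmod (f z))\<^sup>2) absolutely_integrable_on {..0}"
    using assms(1) by (simp add: square_int_def flip: halfline_integrable_iff)
  then have sq: "(\<lambda>z. (cmod (f z))\<^sup>2) integrable_on {a..b}"
    using assms(2) by (intro set_lebesgue_integral_eq_integral(1)
        absolutely_integrable_on_subinterval[where S = "{..0}"]) auto
  have "f absolutely_integrable_on {a..<b}"
  proof (rule measurable_bounded_by_integrable_imp_absolutely_integrable)
    show "f \<in> borel_measurable (lebesgue_on {a..<b})"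
      by (rule measurable_restrict_mono[of f lebesgue "{..<0}"])
        (use assms in \<open>auto simp: square_int_def\<close>)
    have "(\<lambda>z. 1 + (cmod (f z))\<^sup>2) integrable_on {a..b}"
      by (intro Henstock_Kurzweil_Integration.integrable_add sq) auto
    then show "(\<lambda>z. 1 + (cmod (f z))\<^sup>2) integrable_on {a..<b}"
      by (rule integrable_spike_set) (auto intro: negligible_subset[of "{b}"])
    show "cmod (f z) \<le> 1 + (cmod (f z))\<^sup>2" for z
      using sum_squares_bound[of 1 "cmod (f z)"] norm_ge_zero[of "f z"] by (simp; linarith)
  qed auto
  then show ?thesis
    by (rule absolutely_integrable_spike_set) (auto intro: negligible_subset[of "{b}"])
qed

lemma ex_primitive:
  fixes g :: "real \<Rightarrow> 'a::euclidean_space"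
  assumes g: "\<And>a. g absolutely_integrable_on {a..0}"
  shows "primitive (\<lambda>z. - integral {z..0} g) g"
  unfolding primitive_def
proof (intro allI impI conjI)
  fix a b :: real assume ab: "a \<le> b" "b \<le> 0"
  show "g absolutely_integrable_on {a..b}"
    by (rule absolutely_integrable_on_subinterval[OF g[of a]]) (use ab in auto)
  have "g integrable_on {a..0}" using g set_lebesgue_integral_eq_integral(1) by blast
  from Henstock_Kurzweil_Integration.integral_combine[OF ab this]
  show "- integral {b..0} g - - integral {a..0} g = integral {a..b} g"
    by (simp add: algebra_simps)
qed

lemma primitive_add_const: "primitive f g \<Longrightarrow> primitive (\<lambda>z. f z + C) g"
  by (simp add: primitive_def)

lemma sigma_finite_lebesgue: "sigma_finite_measure (lebesgue :: 'a::euclidean_space measure)"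
proof
  obtain A :: "'a set set" where A: "countable A" "A \<subseteq> sets lborel" "\<Union>A = space lborel"
      "\<forall>a\<in>A. emeasure lborel a \<noteq> \<infinity>"
    using lborel.sigma_finite_countable by blast
  show "\<exists>A::'a set set. countable A \<and> A \<subseteq> sets lebesgue \<and> \<Union>A = space lebesgue \<and>
      (\<forall>a\<in>A. emeasure lebesgue a \<noteq> \<infinity>)"
    using A by (intro exI[of _ A]) (auto simp: subset_iff)
qed

text \<open>
  A function whose integral over every interval vanishes is zero almost everywhere: the sets over which its
  integral vanishes form a Dynkin system.
\<close>

lemma AE_zero_on_halfline_if_primitive_const:
  fixes h :: "real \<Rightarrow> 'a::euclidean_space"
  assumes h: "primitive (\<lambda>_. C) h"
  shows "AE z in halfline. h z = 0"
proof -
  have "AE z in lebesgue. indicator {- real n..0} z *\<^sub>R h z = 0" for n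
  proof (rule sigma_finite_measure.density_zero[OF sigma_finite_lebesgue])
    let ?I = "{- real n..0}"
    let ?k = "\<lambda>z. indicator ?I z *\<^sub>R h z"
    show int: "integrable lebesgue ?k"
      using primitive_abs_int[OF h order_refl] by (simp add: set_integrable_def)
    have gen: "sigma_sets UNIV (range (\<lambda>a::real. {..a})) = sets borel"
      by (subst borel_eq_atMost) simp
    have leb: "B \<in> sets lebesgue" if "B \<in> sigma_sets UNIV (range (\<lambda>a::real. {..a}))" for B
      using that by (simp add: gen)
    have borel: "(LINT z:A|lebesgue. ?k z) = 0" if A: "A \<in> sets borel" for A
    proof -
      have "Int_stable (range (\<lambda>a::real. {..a}))"
        by (auto simp: Int_stable_def intro!: image_eqI[of _ _ "min _ _"])
      moreover have "range (\<lambda>a::real. {..a}) \<subseteq> Pow UNIV" by simp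
      moreover have "A \<in> sigma_sets UNIV (range (\<lambda>a::real. {..a}))"
        using A by (simp add: gen)
      ultimately show ?thesis
      proof (induction rule: sigma_sets_induct_disjoint)
        case (basic A)
        then obtain a where a: "A = {..a}" by auto
        have "(LINT z:A|lebesgue. ?k z) = (LINT z:{- real n..min a 0}|lebesgue. h z)"
          unfolding set_lebesgue_integral_def
          by (rule Bochner_Integration.integral_cong) (auto simp: a indicator_def)
        also have "\<dots> = integral {- real n..min a 0} h"
          by (rule set_lebesgue_integral_eq_integral(2)[OF primitive_abs_int[OF h]]) simp
        also have "\<dots> = 0"
          using primitive_diff[OF h, of "- real n" "min a 0"] by (cases "- real n \<le> min a 0") auto
        finally show ?case .
      next
        case empty
        show ?case by (simp add: set_lebesgue_integral_def)
      next
        case (compl A)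
        then have "A \<in> sets lebesgue" by (intro leb)
        have I: "integral\<^sup>L lebesgue ?k = 0"
        proof -
          have "integral\<^sup>L lebesgue ?k = integral ?I h"
            using set_lebesgue_integral_eq_integral(2)[OF primitive_abs_int[OF h order_refl]]
            by (simp add: set_lebesgue_integral_def)
          then show ?thesis using primitive_diff[OF h, of "- real n" 0] by simp
        qed
        have iA: "integrable lebesgue (\<lambda>z. indicator A z *\<^sub>R ?k z)"
          using \<open>A \<in> sets lebesgue\<close> int by (rule integrable_mult_indicator)
        have "(LINT z:UNIV - A|lebesgue. ?k z) = (LINT z|lebesgue. ?k z - indicator A z *\<^sub>R ?k z)"
          unfolding set_lebesgue_integral_def
          by (rule Bochner_Integration.integral_cong) (auto simp: indicator_def)
        also have "\<dots> = (LINT z|lebesgue. ?k z) - (LINT z|lebesgue. indicator A z *\<^sub>R ?k z)"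
          by (rule Bochner_Integration.integral_diff[OF int iA])
        also have "\<dots> = 0" using I compl by (simp add: set_lebesgue_integral_def)
        finally show ?case .
      next
        case (union A)
        have "A i \<in> sets lebesgue" for i
          using union(2) by (intro leb) auto
        moreover from this have "(\<Union>i. A i) \<in> sets lebesgue" by auto
        then have "set_integrable lebesgue (\<Union>i. A i) ?k"
          unfolding set_integrable_def using int by (rule integrable_mult_indicator)
        ultimately have "(LINT z:(\<Union>i. A i)|lebesgue. ?k z) = (\<Sum>i. (LINT z:A i|lebesgue. ?k z))"
          using union(1) by (intro lebesgue_integral_countable_add) (auto simp: disjoint_family_on_def)
        then show ?case using union(3) by simp
      qed
    qed
    fix A :: "real set" assume A: "A \<in> sets lebesgue"
    then obtain S N N' where S: "A = S \<union> N" "N \<subseteq> N'" "N' \<in> null_sets lborel" "S \<in> sets lborel"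
      by (rule sets_completionE)
    have N': "N' \<in> null_sets lebesgue" using S(3) by (rule null_sets_completionI)
    have "(LINT z:A|lebesgue. ?k z) = (LINT z:S|lebesgue. ?k z)"
      unfolding set_lebesgue_integral_def
    proof (rule Bochner_Integration.integral_cong_AE)
      show "(\<lambda>z. indicator A z *\<^sub>R ?k z) \<in> borel_measurable lebesgue"
        by (rule borel_measurable_integrable[OF integrable_mult_indicator[OF A int]])
      show "(\<lambda>z. indicator S z *\<^sub>R ?k z) \<in> borel_measurable lebesgue"
        by (rule borel_measurable_integrable[OF integrable_mult_indicator[OF _ int]]) (use S(4) in auto)
      show "AE z in lebesgue. indicator A z *\<^sub>R ?k z = indicator S z *\<^sub>R ?k z"
        using AE_not_in[OF N'] by eventually_elim (use S in \<open>auto simp: indicator_def\<close>)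
    qed
    then show "(LINT z:A|lebesgue. ?k z) = 0" using borel[of S] S(4) by simp
  qed
  then have "AE z in lebesgue. \<forall>n. indicator {- real n..0} z *\<^sub>R h z = 0"
    unfolding AE_all_countable by blast
  then have "AE z in lebesgue. z < 0 \<longrightarrow> h z = 0"
  proof eventually_elim
    fix z assume A: "\<forall>n. indicator {- real n..0} z *\<^sub>R h z = 0"
    obtain n where "- z \<le> real n" using real_arch_simple by blast
    then show "z < 0 \<longrightarrow> h z = 0" using A[rule_format, of n] by (auto simp: indicator_def)
  qed
  then show ?thesis by (simp add: AE_restrict_space_iff)
qed

text \<open>
  Passing from the compact support inside \<open>(-\<infinity>,0)\<close> to an interval \<open>[A,0]\<close> reduces integrals against
  test functions to integrals over compact intervals.
\<close>

lemma test_function_truncation: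
  assumes "test_function \<phi> \<phi>'"
  obtains A where "A < 0" "\<And>z. z \<le> A \<Longrightarrow> \<phi> z = 0" "\<And>z. z \<le> A \<Longrightarrow> \<phi>' z = 0" "\<phi> 0 = 0"
proof -
  obtain K where K: "compact K" "K \<subseteq> {..<0}" "\<And>z. z \<notin> K \<Longrightarrow> \<phi> z = 0"
    and d: "\<And>z. (\<phi> has_real_derivative \<phi>' z) (at z)"
    using assms by (auto simp: test_function_def)
  obtain B where B: "\<And>z. z \<in> K \<Longrightarrow> \<bar>z\<bar> \<le> B"
    using compact_imp_bounded[OF K(1)] by (auto simp: bounded_iff)
  define A where "A = - \<bar>B\<bar> - 2"
  have out: "\<phi> z = 0" if "z < A + 1" for z
    using that B[of z] K(3)[of z] by (fastforce simp: A_def)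
  show ?thesis
  proof (rule that[of A])
    show "A < 0" by (simp add: A_def)
    show "\<phi> z = 0" if "z \<le> A" for z using out[of z] that by simp
    show "\<phi> 0 = 0" using K by auto
    show "\<phi>' z = 0" if z: "z \<le> A" for z
    proof -
      have "((\<lambda>_. 0) has_real_derivative \<phi>' z) (at z)"
        by (rule has_field_derivative_transform_within_open[OF d, of "{..<A + 1}"]) (use z out in auto)
      then show ?thesis using DERIV_unique DERIV_const by blast
    qed
  qed
qed

lemma test_function_primitive:
  assumes "test_function \<phi> \<phi>'"
  shows "primitive \<phi> \<phi>'"
  using assms
  by (intro primitive_of_deriv)
    (auto simp: test_function_def has_real_derivative_iff_has_vector_derivative[symmetric]
      intro: has_field_derivative_at_within continuous_on_subset)

lemma test_function_by_parts:
  fixes f :: "real \<Rightarrow> 'a::euclidean_space"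
  assumes \<phi>: "test_function \<phi> \<phi>'" and f: "primitive f g"
  shows "(LINT z|halfline. \<phi>' z *\<^sub>R f z) = - (LINT z|halfline. \<phi> z *\<^sub>R g z)"
proof -
  obtain A where A: "A < 0" "\<And>z. z \<le> A \<Longrightarrow> \<phi> z = 0" "\<And>z. z \<le> A \<Longrightarrow> \<phi>' z = 0" "\<phi> 0 = 0"
    using test_function_truncation[OF \<phi>] by blast
  have p: "primitive \<phi> \<phi>'" by (rule test_function_primitive[OF \<phi>])
  have prod: "primitive (\<lambda>z. \<phi> z *\<^sub>R f z) (\<lambda>z. \<phi> z *\<^sub>R g z + \<phi>' z *\<^sub>R f z)"
    by (rule primitive_bilinear[OF p f bounded_bilinear_scaleR])
  have "continuous_on {A..0} \<phi>'"
    using \<phi> continuous_on_subset by (auto simp: test_function_def)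
  then have i2: "(\<lambda>z. \<phi>' z *\<^sub>R f z) absolutely_integrable_on {A..0}"
    by (intro absolutely_integrable_continuous_real continuous_intros primitive_continuous_Icc[OF f]) auto
  have "(\<lambda>z. (\<phi> z *\<^sub>R g z + \<phi>' z *\<^sub>R f z) - \<phi>' z *\<^sub>R f z) absolutely_integrable_on {A..0}"
    by (rule set_integral_diff(1)[OF primitive_abs_int[OF prod order_refl] i2])
  then have i1: "(\<lambda>z. \<phi> z *\<^sub>R g z) absolutely_integrable_on {A..0}" by simp
  have "0 = integral {A..0} (\<lambda>z. \<phi> z *\<^sub>R g z + \<phi>' z *\<^sub>R f z)"
    using primitive_diff[OF prod, of A 0] A by simp
  also have "\<dots> = integral {A..0} (\<lambda>z. \<phi> z *\<^sub>R g z) + integral {A..0} (\<lambda>z. \<phi>' z *\<^sub>R f z)"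
    using i1 i2 by (intro Henstock_Kurzweil_Integration.integral_add)
      (auto dest: set_lebesgue_integral_eq_integral(1))
  finally show ?thesis
    using truncated_halfline_integral(2)[OF i1] truncated_halfline_integral(2)[OF i2] A
    by (simp add: add_eq_0_iff)
qed

lemma test_function_of_mean_zero:
  fixes \<psi> :: "real \<Rightarrow> real"
  assumes ab: "\<alpha> \<le> \<beta>" "\<beta> < 0" and cont: "continuous_on UNIV \<psi>"
    and supp: "\<And>z. z \<notin> {\<alpha>..\<beta>} \<Longrightarrow> \<psi> z = 0"
    and A: "A < \<alpha>" and zero: "integral {A..0} \<psi> = 0"
  shows "test_function (\<lambda>z. integral {A..z} \<psi>) \<psi>"
proof -
  have ii: "\<psi> integrable_on {x..y}" for x y
    by (rule integrable_continuous_real, rule continuous_on_subset[OF cont]) auto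
  have left: "integral {A..z} \<psi> = 0" if "z < \<alpha>" for z
    by (rule integral_unique, rule has_integral_is_0) (use that supp in auto)
  have right: "integral {A..z} \<psi> = 0" if "z > \<beta>" for z
  proof -
    have tail: "integral {\<beta>..y} \<psi> = 0" for y
      by (rule integral_unique, rule has_integral_spike[of "{\<beta>}" _ _ "\<lambda>_. 0"]) (use supp in auto)
    have "integral {A..y} \<psi> = integral {A..\<beta>} \<psi>" if "y \<ge> \<beta>" for y
      using Henstock_Kurzweil_Integration.integral_combine[of A \<beta> y \<psi>] ii that A ab tail[of y] by simp
    from this[of z] this[of 0] show ?thesis using that ab zero by simp
  qed
  show ?thesis
    unfolding test_function_def
  proof (intro conjI allI exI[of _ "{\<alpha>..\<beta>}"] impI)
    fix z
    show "((\<lambda>z. integral {A..z} \<psi>) has_real_derivative \<psi> z) (at z)"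
    proof (cases "z < \<alpha>")
      case True
      have "((\<lambda>_. 0) has_real_derivative \<psi> z) (at z)" using supp[of z] True by simp
      then show ?thesis
        by (rule has_field_derivative_transform_within_open[of _ _ _ "{..<\<alpha>}"]) (use True left in auto)
    next
      case False
      have "((\<lambda>z. integral {A..z} \<psi>) has_real_derivative \<psi> z) (at z within {A..z + 1})"
        by (rule integral_has_real_derivative) (use False A cont continuous_on_subset in auto)
      moreover have "at z within {A..z + 1} = at z"
        by (rule at_within_interior) (use False A in \<open>auto simp: interior_atLeastAtMost_real\<close>)
      ultimately show ?thesis by simp
    qed
  next
    fix z assume "z \<notin> {\<alpha>..\<beta>}"
    then show "integral {A..z} \<psi> = 0" using left right by fastforce
  qed (use cont ab in auto)
qed

text \<open>
  The du Bois-Reymond lemma. With \<open>f\<close> a primitive of the weak derivative, \<open>e = p - f\<close> is orthogonal to all continuous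
  functions of compact support and mean zero. Subtracting a multiple of a fixed bump \<open>\<psi>0\<close> from
  continuous approximations \<open>\<theta> n\<close> of the indicator function of \<open>(a,b)\<close> gives them mean zero, and in the limit
  \<open>\<integral>\<^sub>a\<^sup>b e = (b - a) C\<close> with a constant \<open>C\<close> not depending on the interval, whence \<open>e = C\<close>.
\<close>

lemma weak_deriv_imp_primitive:
  assumes w: "weak_deriv p q"
  obtains f where "primitive f (rep_l2 q)" "AE z in halfline. rep_l2 p z = f z"
proof -
  have sp: "square_int (rep_l2 p)" and sq: "square_int (rep_l2 q)" by (rule square_int_rep)+
  have ip: "rep_l2 p absolutely_integrable_on {a..b}" if "b \<le> 0" for a b
    by (rule square_int_abs_int[OF sp that])
  define f where "f z = - integral {z..0} (rep_l2 q)" for z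
  have f: "primitive f (rep_l2 q)"
    unfolding f_def[abs_def] by (rule ex_primitive[OF square_int_abs_int[OF sq]]) simp
  define e where "e z = rep_l2 p z - f z" for z
  have ie: "e absolutely_integrable_on {a..b}" if "b \<le> 0" for a b
    unfolding e_def[abs_def]
    by (intro set_integral_diff(1) ip that absolutely_integrable_continuous_real primitive_continuous_Icc[OF f])
  have ie': "(\<lambda>z. \<psi> z *\<^sub>R e z) absolutely_integrable_on {a..b}"
    if b: "b \<le> 0" and cont: "continuous_on UNIV \<psi>" for a b and \<psi> :: "real \<Rightarrow> real"
  proof (rule absolutely_integrable_bounded_measurable_product[where h = "(*\<^sub>R)" and f = \<psi>, OF _ _ _ _ ie[OF b]])
    have c: "continuous_on {a..b} \<psi>" by (rule continuous_on_subset[OF cont]) auto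
    show "\<psi> \<in> borel_measurable (lebesgue_on {a..b})"
      by (rule continuous_imp_measurable_on_sets_lebesgue[OF c]) auto
    show "bounded (\<psi> ` {a..b})"
      by (rule compact_imp_bounded[OF compact_continuous_image[OF c]]) auto
    show "bilinear ((*\<^sub>R) :: real \<Rightarrow> complex \<Rightarrow> complex)"
      using bounded_bilinear_scaleR bilinear_conv_bounded_bilinear by blast
  qed auto
  have mean0: "integral {A..0} (\<lambda>z. \<psi> z *\<^sub>R e z) = 0"
    if ab: "\<alpha> \<le> \<beta>" "\<beta> < 0" and cont: "continuous_on UNIV \<psi>"
      and supp: "\<And>z. z \<notin> {\<alpha>..\<beta>} \<Longrightarrow> \<psi> z = 0"
      and A: "A < \<alpha>" and zero: "integral {A..0} \<psi> = 0" for \<psi> :: "real \<Rightarrow> real" and \<alpha> \<beta> A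
  proof -
    let ?\<phi> = "\<lambda>z. integral {A..z} \<psi>"
    have t: "test_function ?\<phi> \<psi>" by (rule test_function_of_mean_zero[OF that])
    have "(LINT z|halfline. \<psi> z *\<^sub>R rep_l2 p z) = - (LINT z|halfline. ?\<phi> z *\<^sub>R rep_l2 q z)"
      using w t by (auto simp: weak_deriv_def)
    also have "\<dots> = (LINT z|halfline. \<psi> z *\<^sub>R f z)"
      using test_function_by_parts[OF t f] by simp
    finally have eq: "(LINT z|halfline. \<psi> z *\<^sub>R rep_l2 p z) = (LINT z|halfline. \<psi> z *\<^sub>R f z)" .
    have c: "continuous_on {A..0} \<psi>" by (rule continuous_on_subset[OF cont]) auto
    have i1: "(\<lambda>z. \<psi> z *\<^sub>R f z) absolutely_integrable_on {A..0}"
      by (intro absolutely_integrable_continuous_real continuous_intros c primitive_continuous_Icc[OF f]) simp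
    have "(\<lambda>z. \<psi> z *\<^sub>R e z + \<psi> z *\<^sub>R f z) absolutely_integrable_on {A..0}"
      by (rule set_integral_add(1)[OF ie'[OF order_refl cont] i1])
    then have i2: "(\<lambda>z. \<psi> z *\<^sub>R rep_l2 p z) absolutely_integrable_on {A..0}"
      by (simp add: e_def algebra_simps)
    have "integral {A..0} (\<lambda>z. \<psi> z *\<^sub>R rep_l2 p z) = integral {A..0} (\<lambda>z. \<psi> z *\<^sub>R f z)"
      using eq truncated_halfline_integral(2)[OF i1] truncated_halfline_integral(2)[OF i2] supp A by simp
    then show ?thesis
      using Henstock_Kurzweil_Integration.integral_diff[of "\<lambda>z. \<psi> z *\<^sub>R rep_l2 p z" "{A..0}" "\<lambda>z. \<psi> z *\<^sub>R f z"]
        i1 i2 by (auto simp: e_def algebra_simps dest: set_lebesgue_integral_eq_integral(1))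
  qed
  define \<psi>0 where "\<psi>0 z = max 0 (min (z + 2) (- 1 - z)) * 4" for z :: real
  have c0: "continuous_on UNIV \<psi>0" unfolding \<psi>0_def by (intro continuous_intros)
  have s0: "\<psi>0 z = 0" if "z \<notin> {-2..-1}" for z using that by (auto simp: \<psi>0_def max_def min_def)
  have i0: "\<psi>0 integrable_on {a..b}" for a b
    by (rule integrable_continuous_real, rule continuous_on_subset[OF c0]) auto
  have "\<exists>m>0. \<forall>A. A < -2 \<longrightarrow> integral {A..0} \<psi>0 = m"
  proof (intro exI conjI allI impI)
    show "integral {-2..0} \<psi>0 > 0"
    proof -
      have "integral {-2..0} \<psi>0 \<ge> 0" by (rule integral_nonneg[OF i0]) (simp add: \<psi>0_def)
      moreover have "integral {-2..0} \<psi>0 \<noteq> 0"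
      proof
        assume "integral {-2..0} \<psi>0 = 0"
        then have "(\<psi>0 has_integral 0) (cbox (-2) 0)" using i0[of "-2" 0] by (simp add: has_integral_integrable_integral)
        then have "\<psi>0 (-3/2) = 0"
          by (rule has_integral_0_cbox_imp_0[rotated 2])
            (use continuous_on_subset[OF c0, of "{-2..0}"] in \<open>auto simp: \<psi>0_def[abs_def]\<close>)
        then show False by (simp add: \<psi>0_def)
      qed
      ultimately show ?thesis by simp
    qed
    fix A :: real assume "A < -2"
    then show "integral {A..0} \<psi>0 = integral {-2..0} \<psi>0"
      using Henstock_Kurzweil_Integration.integral_combine[of A "-2" 0 \<psi>0] i0
        integral_unique[OF has_integral_spike[of "{-2}" "{A..-2}" \<psi>0 "\<lambda>_. 0" 0]] s0 by auto
  qed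
  then obtain m where m: "m > 0" "\<And>A. A < -2 \<Longrightarrow> integral {A..0} \<psi>0 = m" by blast
  define C where "C = integral {-3..0} (\<lambda>z. \<psi>0 z *\<^sub>R e z) /\<^sub>R m"
  have C: "integral {A..0} (\<lambda>z. \<psi>0 z *\<^sub>R e z) = m *\<^sub>R C" if "A \<le> -3" for A
  proof -
    have "integral {A..-3} (\<lambda>z. \<psi>0 z *\<^sub>R e z) = 0"
      by (rule integral_unique, rule has_integral_is_0) (use s0 in auto)
    then show ?thesis
      using Henstock_Kurzweil_Integration.integral_combine[of A "-3" 0 "\<lambda>z. \<psi>0 z *\<^sub>R e z"] that m(1)
        ie'[OF order_refl c0, of A] by (simp add: C_def set_lebesgue_integral_eq_integral(1))
  qed
  have const: "integral {a..b} e = (b - a) *\<^sub>R C" if ab: "a < b" "b \<le> 0" for a b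
  proof -
    define A where "A = min a (-2) - 1"
    \<comment> \<open>The term \<open>- 1\<close> keeps the support away from \<open>b\<close>, which may be the boundary point 0.\<close>
    define \<theta> where "\<theta> n z = max 0 (min 1 (min (real (Suc n) * (z - a)) (real (Suc n) * (b - z) - 1)))" for n z
    have c\<theta>: "continuous_on UNIV (\<theta> n)" for n unfolding \<theta>_def by (intro continuous_intros)
    have s\<theta>: "\<theta> n z = 0" if "z \<notin> {a..b - 1 / real (Suc n)}" for n z
    proof -
      have "real (Suc n) * (z - a) \<le> 0 \<or> real (Suc n) * (b - z) - 1 \<le> 0"
      proof (cases "z < a")
        case True
        then show ?thesis by (intro disjI1 mult_nonneg_nonpos) auto
      next
        case False
        then have "b - z < 1 / real (Suc n)" using that by auto
        then show ?thesis by (simp add: field_simps)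
      qed
      moreover have "max 0 (min 1 (min x y)) = 0" if "x \<le> 0 \<or> y \<le> 0" for x y :: real
        using that by auto
      ultimately show ?thesis unfolding \<theta>_def by blast
    qed
    have i\<theta>: "\<theta> n integrable_on {x..y}" for n x y
      by (rule integrable_continuous_real, rule continuous_on_subset[OF c\<theta>]) auto
    have bd: "0 \<le> \<theta> n z" "\<theta> n z \<le> 1" for n z by (auto simp: \<theta>_def)
    have lim: "(\<lambda>n. \<theta> n z) \<longlonglongrightarrow> indicator {a<..<b} z" for z
    proof (cases "a < z \<and> z < b")
      case True
      obtain N :: nat where "max (1 / (z - a)) (2 / (b - z)) < real N"
        using reals_Archimedean2 by blast
      then have N: "1 / (z - a) < real N" "2 / (b - z) < real N" by auto
      have "\<theta> n z = 1" if "n \<ge> N" for n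
      proof -
        have "1 / (z - a) \<le> real (Suc n)" "2 / (b - z) \<le> real (Suc n)" using N that by auto
        then have "1 \<le> real (Suc n) * (z - a)" "2 \<le> real (Suc n) * (b - z)"
          using True by (auto simp: divide_le_eq mult.commute)
        then show ?thesis by (auto simp: \<theta>_def)
      qed
      then have "eventually (\<lambda>n. \<theta> n z = 1) sequentially" by (auto simp: eventually_sequentially)
      then show ?thesis using True by (simp add: tendsto_eventually)
    next
      case False
      have "\<theta> n z = 0" for n
      proof (cases "z \<in> {a..b - 1 / real (Suc n)}")
        case True
        moreover have "1 / real (Suc n) > 0" by simp
        ultimately have "z = a" using False unfolding atLeastAtMost_iff by linarith
        then show ?thesis by (simp add: \<theta>_def)
      qed (rule s\<theta>)
      then show ?thesis using False by auto
    qed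
    have key: "integral {A..0} (\<lambda>z. \<theta> n z *\<^sub>R e z) = integral {A..0} (\<theta> n) *\<^sub>R C" for n
    proof -
      define t where "t = integral {A..0} (\<theta> n) / m"
      define \<psi> where "\<psi> z = \<theta> n z - t * \<psi>0 z" for z
      have i\<psi>: "(\<lambda>z. t * \<psi>0 z) integrable_on {A..0}" using i0 by (rule integrable_on_mult_right)
      have "integral {A..0} (\<lambda>z. \<psi> z *\<^sub>R e z) = 0"
      proof (rule mean0[of "min a (-2)" "max (b - 1 / real (Suc n)) (-1)"])
        show "max (b - 1 / real (Suc n)) (-1) < 0"
          using ab le_less_trans[of b 0 "1 / real (Suc n)"] by simp
        show "continuous_on UNIV \<psi>" unfolding \<psi>_def by (intro continuous_intros c\<theta> c0)
        show "\<psi> z = 0" if "z \<notin> {min a (-2)..max (b - 1 / real (Suc n)) (-1)}" for z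
        proof -
          have "z \<notin> {a..b - 1 / real (Suc n)}" "z \<notin> {-2..-1}"
            using that by (auto simp: min_le_iff_disj le_max_iff_disj)
          then show ?thesis using s\<theta>[of z n] s0[of z] by (simp add: \<psi>_def)
        qed
        show "integral {A..0} \<psi> = 0"
          unfolding \<psi>_def[abs_def]
          using Henstock_Kurzweil_Integration.integral_diff[OF i\<theta>[of n A 0] i\<psi>] m(1) m(2)[of A]
          by (simp add: t_def A_def)
      qed (auto simp: A_def)
      moreover have "integral {A..0} (\<lambda>z. \<psi> z *\<^sub>R e z) =
          integral {A..0} (\<lambda>z. \<theta> n z *\<^sub>R e z) - t *\<^sub>R integral {A..0} (\<lambda>z. \<psi>0 z *\<^sub>R e z)"
      proof -
        have i1: "(\<lambda>z. \<theta> n z *\<^sub>R e z) integrable_on {A..0}" "(\<lambda>z. \<psi>0 z *\<^sub>R e z) integrable_on {A..0}"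
          using ie'[OF order_refl c\<theta>] ie'[OF order_refl c0] by (auto dest: set_lebesgue_integral_eq_integral(1))
        show ?thesis
          unfolding \<psi>_def scaleR_diff_left scaleR_scaleR[symmetric]
          using Henstock_Kurzweil_Integration.integral_diff[OF i1(1) integrable_cmul[OF i1(2), of t]]
          by (simp only: integral_cmul)
      qed
      ultimately show ?thesis using C[of A] m(1) by (simp add: t_def A_def)
    qed
    have ie1: "(\<lambda>z. norm (e z)) integrable_on {A..0}"
      using absolutely_integrable_norm[OF ie[OF order_refl]] by (auto simp: o_def dest: set_lebesgue_integral_eq_integral(1))
    have l1: "(\<lambda>n. integral {A..0} (\<lambda>z. \<theta> n z *\<^sub>R e z)) \<longlonglongrightarrow> integral {A..0} (\<lambda>z. indicator {a<..<b} z *\<^sub>R e z)"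
    proof (rule dominated_convergence(2)[OF _ ie1])
      show "(\<lambda>z. \<theta> k z *\<^sub>R e z) integrable_on {A..0}" for k
        using ie'[OF order_refl c\<theta>] by (auto dest: set_lebesgue_integral_eq_integral(1))
      show "norm (\<theta> k z *\<^sub>R e z) \<le> norm (e z)" for k z
        using bd[of k z] by (simp add: mult_left_le_one_le)
    qed (intro tendsto_intros lim)
    have l2: "(\<lambda>n. integral {A..0} (\<theta> n)) \<longlonglongrightarrow> integral {A..0} (indicator {a<..<b})"
    proof (rule dominated_convergence(2)[where h = "\<lambda>_. 1"])
      show "norm (\<theta> k z) \<le> 1" for k z using bd[of k z] by simp
    qed (use i\<theta> lim in auto)
    have r1: "integral {A..0} (\<lambda>z. indicator {a<..<b} z *\<^sub>R e z) = integral {a..b} e"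
    proof -
      have "integral {A..0} (\<lambda>z. indicator {a<..<b} z *\<^sub>R e z) = integral {A..0} (\<lambda>z. if z \<in> {a<..<b} then e z else 0)"
        by (rule integral_cong) auto
      also have "\<dots> = integral {a<..<b} e"
        by (subst integral_restrict_Int) (use ab in \<open>auto simp: A_def intro!: arg_cong2[where f = integral]\<close>)
      finally show ?thesis by (simp add: integral_open_interval_real)
    qed
    have r2: "integral {A..0} (indicator {a<..<b}) = b - a"
    proof -
      have "integral {A..0} (indicator {a<..<b}) = integral {A..0} (\<lambda>z. if z \<in> {a<..<b} then 1 else (0::real))"
        by (rule integral_cong) auto
      also have "\<dots> = integral {a<..<b} (\<lambda>_. 1)"
        by (subst integral_restrict_Int) (use ab in \<open>auto simp: A_def intro!: arg_cong2[where f = integral]\<close>)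
      also have "\<dots> = integral {a..b} (\<lambda>_. 1)" by (rule integral_open_interval_real[symmetric])
      finally show ?thesis using ab by simp
    qed
    show ?thesis
      using LIMSEQ_unique[OF l1[unfolded key r1] tendsto_scaleR[OF l2[unfolded r2] tendsto_const]] .
  qed
  have "primitive (\<lambda>_. 0) (\<lambda>z. e z - C)"
    unfolding primitive_def
  proof (intro allI impI conjI)
    fix a b :: real assume ab: "a \<le> b" "b \<le> 0"
    show "(\<lambda>z. e z - C) absolutely_integrable_on {a..b}"
      by (intro set_integral_diff(1) ie ab absolutely_integrable_continuous_real continuous_intros)
    show "0 - 0 = integral {a..b} (\<lambda>z. e z - C)"
      using const[of a b] ab ie[OF ab(2), of a]
      by (cases "a = b") (auto simp: Henstock_Kurzweil_Integration.integral_diff set_lebesgue_integral_eq_integral(1))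
  qed
  then have "AE z in halfline. e z - C = 0" by (rule AE_zero_on_halfline_if_primitive_const)
  then have "AE z in halfline. rep_l2 p z = f z + C"
    by eventually_elim (simp add: e_def algebra_simps)
  with primitive_add_const[OF f] show ?thesis by (rule that)
qed


section \<open>The space of square-integrable functions is complete\<close>

lemma AE_rep_plus: "AE z in halfline. rep_l2 (p + q) z = rep_l2 p z + rep_l2 q z"
  unfolding plus_l2_def map_fun_apply
  by (rule rep_abs_l2[OF square_int_add[OF square_int_rep square_int_rep]])

lemma AE_rep_diff: "AE z in halfline. rep_l2 (p - q) z = rep_l2 p z - rep_l2 q z"
  unfolding minus_l2_def map_fun_apply
  by (rule rep_abs_l2[OF square_int_diff[OF square_int_rep square_int_rep]])

lemma AE_rep_scaleR: "AE z in halfline. rep_l2 (k *\<^sub>R p) z = k *\<^sub>R rep_l2 p z"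
  unfolding scaleR_l2_def map_fun_apply id_apply
  by (rule rep_abs_l2[OF square_int_scaleR[OF square_int_rep]])

lemma AE_rep_scaleC: "AE z in halfline. rep_l2 (k *\<^sub>C p) z = k * rep_l2 p z"
  unfolding scaleC_def map_fun_apply id_apply
  by (rule rep_abs_l2[OF square_int_cmult[OF square_int_rep]])

lemma square_int_cong_AE:
  assumes "square_int f" "g \<in> borel_measurable halfline" "AE z in halfline. f z = g z"
  shows "square_int g"
proof -
  have m: "(\<lambda>z. (cmod (g z))\<^sup>2) \<in> borel_measurable halfline" using assms(2) by measurable
  show ?thesis
    unfolding square_int_def
  proof (intro conjI assms(2))
    show "integrable halfline (\<lambda>z. (cmod (g z))\<^sup>2)"
      by (rule integrable_cong_AE_imp[OF _ m, of "\<lambda>z. (cmod (f z))\<^sup>2"])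
        (use assms in \<open>auto simp: square_int_def\<close>)
  qed
qed

lemma norm_l2_square:
  assumes "square_int f" "AE z in halfline. rep_l2 p z = f z"
  shows "(norm p)\<^sup>2 = (LINT z|halfline. (cmod (f z))\<^sup>2)"
proof -
  have "rep_l2 p \<in> borel_measurable halfline" "f \<in> borel_measurable halfline"
    using square_int_rep[of p] assms(1) by (auto simp: square_int_def)
  then have "(LINT z|halfline. (cmod (rep_l2 p z))\<^sup>2) = (LINT z|halfline. (cmod (f z))\<^sup>2)"
    by (intro integral_cong_AE) (use assms(2) in auto)
  then show ?thesis by (simp add: norm_l2_eq)
qed

lemma norm_l2_diff_square:
  "ennreal ((norm (p - q))\<^sup>2) = (\<integral>\<^sup>+z. ennreal ((cmod (rep_l2 p z - rep_l2 q z))\<^sup>2) \<partial>halfline)"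
proof -
  have s: "square_int (\<lambda>z. rep_l2 p z - rep_l2 q z)"
    by (intro square_int_diff square_int_rep)
  show ?thesis
    unfolding norm_l2_square[OF s AE_rep_diff]
    by (rule nn_integral_eq_integral[symmetric]) (use s in \<open>auto simp: square_int_def\<close>)
qed

text \<open>
  The Riesz-Fischer theorem. Along a subsequence with increments at most \<open>2\<^sup>-\<^sup>k\<close> in norm, the functions
  \<open>2\<^sup>k |F (k+1) - F k|\<^sup>2\<close> have a summable series of integrals, so the series of functions converges almost everywhere;
  since \<open>|x| \<le> 2\<^sup>-\<^sup>k + 2\<^sup>k |x|\<^sup>2\<close>, so does the telescoping series. Fatou's lemma turns the pointwise limit into a
  limit in norm.
\<close>

lemma complete_l2: "complete (UNIV :: l2 set)"
proof (rule completeI)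
  fix X :: "nat \<Rightarrow> l2" assume X: "Cauchy X"
  have "\<exists>N. \<forall>m\<ge>N. \<forall>n\<ge>N. dist (X m) (X n) < (1/2) ^ k" for k
    using X[unfolded Cauchy_def] by (meson half_gt_zero zero_less_one zero_less_power)
  then obtain N where N: "\<And>k m n. m \<ge> N k \<Longrightarrow> n \<ge> N k \<Longrightarrow> dist (X m) (X n) < (1/2) ^ k"
    by metis
  define r where "r k = (\<Sum>j\<le>k. N j) + k" for k
  have r_mono: "strict_mono r" by (rule strict_monoI_Suc) (simp add: r_def)
  have r_ge: "r m \<ge> N k" if "m \<ge> k" for m k
  proof -
    have "N k \<le> (\<Sum>j\<le>m. N j)" using that by (intro member_le_sum) auto
    then show ?thesis by (simp add: r_def)
  qed
  define F where "F k = rep_l2 (X (r k))" for k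
  have F[measurable]: "F k \<in> borel_measurable halfline" for k
    using square_int_rep by (simp add: square_int_def F_def)
  have close: "(\<integral>\<^sup>+z. ennreal ((cmod (F m z - F k z))\<^sup>2) \<partial>halfline) \<le> ennreal ((1/4) ^ k)"
    if "m \<ge> k" for m k
  proof -
    have "norm (X (r m) - X (r k)) \<le> (1/2) ^ k"
      using N[OF r_ge[OF that] r_ge[OF order_refl]] by (simp add: dist_norm less_imp_le)
    then have "(norm (X (r m) - X (r k)))\<^sup>2 \<le> ((1/2) ^ k)\<^sup>2"
      by (intro power_mono) auto
    also have "((1/2) ^ k)\<^sup>2 = (1/4 :: real) ^ k"
      by (simp add: power2_eq_square flip: power_mult_distrib)
    finally show ?thesis
      unfolding F_def norm_l2_diff_square[symmetric] by (simp add: ennreal_leI)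
  qed
  define d where "d k z = 2 ^ k * (cmod (F (Suc k) z - F k z))\<^sup>2" for k z
  have dm[measurable]: "d k \<in> borel_measurable halfline" for k unfolding d_def by measurable
  have d: "(\<integral>\<^sup>+z. ennreal (d k z) \<partial>halfline) \<le> ennreal ((1/2) ^ k)" for k
  proof -
    have "(\<integral>\<^sup>+z. ennreal (d k z) \<partial>halfline)
        = (\<integral>\<^sup>+z. ennreal (2 ^ k) * ennreal ((cmod (F (Suc k) z - F k z))\<^sup>2) \<partial>halfline)"
      by (simp add: d_def ennreal_mult')
    also have "\<dots> = ennreal (2 ^ k) * (\<integral>\<^sup>+z. ennreal ((cmod (F (Suc k) z - F k z))\<^sup>2) \<partial>halfline)"
      by (rule nn_integral_cmult) measurable
    also have "\<dots> \<le> ennreal (2 ^ k) * ennreal ((1/4) ^ k)"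
      by (intro mult_left_mono close) auto
    also have "\<dots> = ennreal ((1/2) ^ k)"
      by (simp add: ennreal_mult'[symmetric] flip: power_mult_distrib)
    finally show ?thesis .
  qed
  have "(\<integral>\<^sup>+z. (\<Sum>k. ennreal (d k z)) \<partial>halfline) = (\<Sum>k. \<integral>\<^sup>+z. ennreal (d k z) \<partial>halfline)"
    by (rule nn_integral_suminf) measurable
  also have "\<dots> \<le> (\<Sum>k. ennreal ((1/2) ^ k))" by (intro suminf_le d) auto
  also have "\<dots> = ennreal (\<Sum>k. (1/2) ^ k)" by (rule suminf_ennreal2) auto
  also have "\<dots> < \<infinity>" by simp
  finally have "AE z in halfline. (\<Sum>k. ennreal (d k z)) \<noteq> \<infinity>"
    by (intro nn_integral_PInf_AE) auto
  then have conv: "AE z in halfline. convergent (\<lambda>k. F k z)"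
  proof eventually_elim
    fix z assume "(\<Sum>k. ennreal (d k z)) \<noteq> \<infinity>"
    then have "summable (\<lambda>k. d k z)"
      by (intro summable_suminf_not_top) (auto simp: d_def)
    then have "summable (\<lambda>k. (1/2) ^ k + d k z)"
      by (intro summable_add summable_geometric) auto
    then have "summable (\<lambda>k. F (Suc k) z - F k z)"
    proof (rule summable_comparison_test'[of _ 0])
      fix k
      let ?x = "cmod (F (Suc k) z - F k z)"
      have "2 ^ k * ?x \<le> 2 ^ k * ((1/2) ^ k + d k z)"
      proof -
        have "2 ^ k * ?x \<le> 1 + (2 ^ k * ?x)\<^sup>2"
        proof -
          have "2 * (2 ^ k * ?x) \<le> 1 + (2 ^ k * ?x)\<^sup>2"
            using sum_squares_bound[of 1 "2 ^ k * ?x"] by simp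
          moreover have "0 \<le> 2 ^ k * ?x" by simp
          ultimately show ?thesis by linarith
        qed
        also have "\<dots> = 2 ^ k * ((1/2) ^ k + d k z)"
          by (simp add: d_def algebra_simps power2_eq_square flip: power_mult_distrib)
        finally show ?thesis .
      qed
      then show "norm (F (Suc k) z - F k z) \<le> (1/2) ^ k + d k z" by simp
    qed
    then have "convergent (\<lambda>n. \<Sum>k<n. F (Suc k) z - F k z)"
      by (simp add: summable_iff_convergent)
    then have "convergent (\<lambda>n. F n z - F 0 z)"
      by (simp only: sum_lessThan_telescope[of "\<lambda>k. F k z"])
    then have "convergent (\<lambda>n. (F n z - F 0 z) + F 0 z)" by (intro convergent_add convergent_const)
    then show "convergent (\<lambda>k. F k z)" by simp
  qed
  define f where "f z = lim (\<lambda>k. F k z)" for z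
  have fm[measurable]: "f \<in> borel_measurable halfline" unfolding f_def by measurable
  have lim: "AE z in halfline. (\<lambda>k. F k z) \<longlonglongrightarrow> f z"
    using conv by eventually_elim (simp add: f_def convergent_LIMSEQ_iff)
  have fk: "(\<integral>\<^sup>+z. ennreal ((cmod (f z - F k z))\<^sup>2) \<partial>halfline) \<le> ennreal ((1/4) ^ k)" for k
  proof -
    have "AE z in halfline. ennreal ((cmod (f z - F k z))\<^sup>2) = liminf (\<lambda>m. ennreal ((cmod (F m z - F k z))\<^sup>2))"
      using lim
    proof eventually_elim
      fix z assume "(\<lambda>k. F k z) \<longlonglongrightarrow> f z"
      then have "(\<lambda>m. ennreal ((cmod (F m z - F k z))\<^sup>2)) \<longlonglongrightarrow> ennreal ((cmod (f z - F k z))\<^sup>2)"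
        by (intro tendsto_intros)
      then show "ennreal ((cmod (f z - F k z))\<^sup>2) = liminf (\<lambda>m. ennreal ((cmod (F m z - F k z))\<^sup>2))"
        by (rule lim_imp_Liminf[OF trivial_limit_sequentially, symmetric])
    qed
    then have "(\<integral>\<^sup>+z. ennreal ((cmod (f z - F k z))\<^sup>2) \<partial>halfline)
        = (\<integral>\<^sup>+z. liminf (\<lambda>m. ennreal ((cmod (F m z - F k z))\<^sup>2)) \<partial>halfline)"
      by (rule nn_integral_cong_AE)
    also have "\<dots> \<le> liminf (\<lambda>m. \<integral>\<^sup>+z. ennreal ((cmod (F m z - F k z))\<^sup>2) \<partial>halfline)"
      by (rule nn_integral_liminf) measurable
    also have "\<dots> \<le> liminf (\<lambda>m. ennreal ((1/4) ^ k))"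
      by (rule Liminf_mono) (auto simp: eventually_sequentially intro!: exI[of _ k] close)
    also have "\<dots> = ennreal ((1/4) ^ k)" by (simp add: Liminf_const)
    finally show ?thesis .
  qed
  have sk: "square_int (\<lambda>z. f z - F k z)" for k
    unfolding square_int_def
  proof (intro conjI integrableI_bounded)
    show "(\<integral>\<^sup>+z. ennreal (norm ((cmod (f z - F k z))\<^sup>2)) \<partial>halfline) < \<infinity>"
      using le_less_trans[OF fk[of k]] by simp
  qed measurable
  have "square_int (\<lambda>z. (f z - F 0 z) + F 0 z)"
    using sk[of 0] square_int_rep by (intro square_int_add) (auto simp: F_def)
  then have sf: "square_int f" by simp
  have rf: "AE z in halfline. rep_l2 (abs_l2 f) z = f z" by (rule rep_abs_l2[OF sf])
  have norm_le: "norm (X (r k) - abs_l2 f) \<le> (1/2) ^ k" for k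
  proof -
    have "ennreal ((norm (abs_l2 f - X (r k)))\<^sup>2)
        = (\<integral>\<^sup>+z. ennreal ((cmod (f z - F k z))\<^sup>2) \<partial>halfline)"
      unfolding norm_l2_diff_square
      by (rule nn_integral_cong_AE) (use rf in \<open>eventually_elim, simp add: F_def\<close>)
    also have "\<dots> \<le> ennreal ((1/4) ^ k)" by (rule fk)
    finally have "(norm (abs_l2 f - X (r k)))\<^sup>2 \<le> (1/4) ^ k" by simp
    also have "(1/4 :: real) ^ k = ((1/2) ^ k)\<^sup>2"
      by (simp add: power2_eq_square flip: power_mult_distrib)
    finally have "norm (abs_l2 f - X (r k)) \<le> (1/2) ^ k" by (rule power2_le_imp_le) simp
    then show ?thesis by (simp only: norm_minus_commute)
  qed
  have "(\<lambda>k. X (r k) - abs_l2 f) \<longlonglongrightarrow> 0"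
    by (rule Lim_null_comparison[of _ "\<lambda>k. (1/2) ^ k"])
      (use norm_le in \<open>auto intro: LIMSEQ_power_zero\<close>)
  then have "(X \<circ> r) \<longlonglongrightarrow> abs_l2 f" by (simp add: LIM_zero_iff o_def)
  then have "X \<longlonglongrightarrow> abs_l2 f" by (rule Cauchy_converges_subseq[OF X r_mono])
  then show "\<exists>l\<in>UNIV. X \<longlonglongrightarrow> l" by blast
qed


section \<open>The domain of the operator\<close>

lemma halfline_measurable:
  fixes f :: "real \<Rightarrow> 'a::{euclidean_space}"
  shows "continuous_on {..0} f \<Longrightarrow> f \<in> borel_measurable halfline"
  by (rule continuous_imp_measurable_on_sets_lebesgue[OF continuous_on_subset]) auto

lemma continuous_eq_if_AE_eq:
  fixes f g :: "real \<Rightarrow> 'a::{euclidean_space}"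
  assumes f: "continuous_on {..0} f" and g: "continuous_on {..0} g"
    and ae: "AE z in halfline. f z = g z" and z: "z \<le> 0"
  shows "f z = g z"
proof -
  define e where "e z = f z - g z" for z
  have e: "continuous_on {..0} e" unfolding e_def by (intro continuous_intros f g)
  have op: "open ({..<0} \<inter> e -` (- {0}))"
    by (rule continuous_open_preimage[OF continuous_on_subset[OF e]]) auto
  have "AE z in lebesgue. z < 0 \<longrightarrow> f z = g z"
    using ae by (simp add: AE_restrict_space_iff)
  then obtain N where N: "\<And>z. z \<in> space lebesgue - N \<Longrightarrow> z < 0 \<longrightarrow> f z = g z" "N \<in> null_sets lebesgue"
    by (rule AE_E3) (rule that)
  have "negligible N" using N(2) by (simp add: negligible_iff_null_sets)
  then have "negligible ({..<0} \<inter> e -` (- {0}))"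
    by (rule negligible_subset) (use N(1) in \<open>auto simp: e_def\<close>)
  then have "{..<0} \<inter> e -` (- {0}) = {}" using open_not_negligible[OF op] by blast
  then have "\<forall>z\<in>{..<0}. e z = 0" by blast
  moreover have "closure {..<0::real} = {..0}" by simp
  ultimately have "e z = 0"
    using continuous_constant_on_closure[of "{..<0}" e 0 z] e z by auto
  then show ?thesis by (simp add: e_def)
qed

lemma primitive_cong:
  "primitive f g \<Longrightarrow> (\<And>z. z \<le> 0 \<Longrightarrow> f z = F z) \<Longrightarrow> primitive F g"
  by (auto simp: primitive_def)

lemma weak_derivI:
  assumes f: "primitive f (rep_l2 q)" and p: "AE z in halfline. rep_l2 p z = f z"
  shows "weak_deriv p q"
  unfolding weak_deriv_def
proof (intro allI impI)
  fix \<phi> \<phi>' assume t: "test_function \<phi> \<phi>'"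
  have "continuous_on {..0} \<phi>'" using t continuous_on_subset by (auto simp: test_function_def)
  then have m: "\<phi>' \<in> borel_measurable halfline" by (rule halfline_measurable)
  have fm: "f \<in> borel_measurable halfline" by (rule halfline_measurable[OF primitive_continuous[OF f]])
  have pm: "rep_l2 p \<in> borel_measurable halfline" using square_int_rep[of p] by (simp add: square_int_def)
  have "(LINT z|halfline. \<phi>' z *\<^sub>R rep_l2 p z) = (LINT z|halfline. \<phi>' z *\<^sub>R f z)"
    using m fm pm by (intro integral_cong_AE) (use p in auto)
  then show "(LINT z|halfline. \<phi>' z *\<^sub>R rep_l2 p z) = - (LINT z|halfline. \<phi> z *\<^sub>R rep_l2 q z)"
    using test_function_by_parts[OF t f] by simp
qed

lemma primitive_diff_fun:
  assumes "primitive f g" "primitive F G"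
  shows "primitive (\<lambda>z. f z - F z) (\<lambda>z. g z - G z)"
  using primitive_add[OF assms(1) primitive_linear[OF assms(2) bounded_linear_minus[OF bounded_linear_ident]]]
  by simp

lemma weak_deriv_unique:
  assumes "weak_deriv p q" "weak_deriv p r"
  shows "q = r"
proof -
  obtain f where f: "primitive f (rep_l2 q)" "AE z in halfline. rep_l2 p z = f z"
    using weak_deriv_imp_primitive[OF assms(1)] .
  obtain g where g: "primitive g (rep_l2 r)" "AE z in halfline. rep_l2 p z = g z"
    using weak_deriv_imp_primitive[OF assms(2)] .
  have ae: "AE z in halfline. f z = g z" using f(2) g(2) by eventually_elim simp
  have "f z - g z = 0" if "z \<le> 0" for z
    using continuous_eq_if_AE_eq[OF primitive_continuous[OF f(1)] primitive_continuous[OF g(1)] ae that]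
    by (rule right_minus_eq[THEN iffD2])
  then have "primitive (\<lambda>z. 0) (\<lambda>z. rep_l2 q z - rep_l2 r z)"
    by (rule primitive_cong[OF primitive_diff_fun[OF f(1) g(1)]])
  from AE_zero_on_halfline_if_primitive_const[OF this] show ?thesis
    unfolding l2_eq_iff right_minus_eq .
qed

lemma wderiv_eq:
  assumes "weak_deriv p q"
  shows "wderiv p = q"
  unfolding wderiv_def using assms weak_deriv_unique[OF _ assms] by (rule the_equality)

text \<open>
  Elements of the domain are handled through a \<open>C\<^sup>1\<close> representative \<open>f\<close> up to the boundary, with
  \<open>g = f'\<close> absolutely continuous; \<open>f 0 = 0\<close> because continuous representatives are unique.
\<close>

lemma dom_L_representatives:
  assumes "p \<in> dom_L"
  obtains f g where "primitive f g" "primitive g (rep_l2 (wderiv (wderiv p)))"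
    "AE z in halfline. rep_l2 p z = f z" "AE z in halfline. rep_l2 (wderiv p) z = g z"
    "f 0 = 0" "square_int f" "square_int g"
proof -
  obtain q r where qr: "weak_deriv p q" "weak_deriv q r"
    using assms by (auto simp: dom_L_def H2_def)
  obtain f where f: "primitive f (rep_l2 q)" "AE z in halfline. rep_l2 p z = f z"
    using weak_deriv_imp_primitive[OF qr(1)] .
  obtain g where g: "primitive g (rep_l2 r)" "AE z in halfline. rep_l2 q z = g z"
    using weak_deriv_imp_primitive[OF qr(2)] .
  obtain h where h: "continuous_on {..0} h" "AE z in halfline. rep_l2 p z = h z" "h 0 = 0"
    using assms by (auto simp: dom_L_def vanishes_at_0_def)
  have "AE z in halfline. f z = h z" using f(2) h(2) by eventually_elim simp
  from continuous_eq_if_AE_eq[OF primitive_continuous[OF f(1)] h(1) this order_refl]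
  have f0: "f 0 = 0" using h(3) by simp
  have sf: "square_int f"
    by (rule square_int_cong_AE[OF square_int_rep halfline_measurable[OF primitive_continuous[OF f(1)]] f(2)])
  have sg: "square_int g"
    by (rule square_int_cong_AE[OF square_int_rep halfline_measurable[OF primitive_continuous[OF g(1)]] g(2)])
  have w: "wderiv p = q" "wderiv q = r" using qr wderiv_eq by auto
  show ?thesis
    by (rule that[OF primitive_cong_AE[OF f(1) g(2)], unfolded w, OF g(1) f(2) g(2) f0 sf sg])
qed

lemma dom_L_memberI:
  assumes f: "primitive f g" and g: "primitive g r"
    and sq: "square_int f" "square_int g" "square_int r" and "f 0 = 0"
  shows "abs_l2 f \<in> dom_L" "wderiv (abs_l2 f) = abs_l2 g" "wderiv (abs_l2 g) = abs_l2 r"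
proof -
  have rep: "AE z in halfline. rep_l2 (abs_l2 h) z = h z" "AE z in halfline. h z = rep_l2 (abs_l2 h) z"
    if "square_int h" for h
    using rep_abs_l2[OF that] by auto
  have w: "weak_deriv (abs_l2 f) (abs_l2 g)" "weak_deriv (abs_l2 g) (abs_l2 r)"
    by (rule weak_derivI[OF primitive_cong_AE[OF f rep(2)[OF sq(2)]] rep(1)[OF sq(1)]])
      (rule weak_derivI[OF primitive_cong_AE[OF g rep(2)[OF sq(3)]] rep(1)[OF sq(2)]])
  then show "wderiv (abs_l2 f) = abs_l2 g" "wderiv (abs_l2 g) = abs_l2 r"
    by (auto intro: wderiv_eq)
  have "vanishes_at_0 (abs_l2 f)"
    unfolding vanishes_at_0_def using primitive_continuous[OF f] rep(1)[OF sq(1)] \<open>f 0 = 0\<close> by blast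
  with w show "abs_l2 f \<in> dom_L" by (auto simp: dom_L_def H2_def)
qed

lemma dom_L_diff:
  assumes "p \<in> dom_L" "q \<in> dom_L"
  shows "p - q \<in> dom_L" "wderiv (p - q) = wderiv p - wderiv q"
    "wderiv (wderiv (p - q)) = wderiv (wderiv p) - wderiv (wderiv q)"
proof -
  obtain f g where f: "primitive f g" "primitive g (rep_l2 (wderiv (wderiv p)))"
    "AE z in halfline. rep_l2 p z = f z" "AE z in halfline. rep_l2 (wderiv p) z = g z" "f 0 = 0"
    using dom_L_representatives[OF assms(1)] by metis
  obtain F G where F: "primitive F G" "primitive G (rep_l2 (wderiv (wderiv q)))"
    "AE z in halfline. rep_l2 q z = F z" "AE z in halfline. rep_l2 (wderiv q) z = G z" "F 0 = 0"
    using dom_L_representatives[OF assms(2)] by metis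
  have rep0: "AE z in halfline. rep_l2 (p - q) z = f z - F z"
    using AE_rep_diff[of p q] f(3) F(3) by eventually_elim simp
  have rep1: "AE z in halfline. rep_l2 (wderiv p - wderiv q) z = g z - G z"
    using AE_rep_diff[of "wderiv p" "wderiv q"] f(4) F(4) by eventually_elim simp
  have w1: "weak_deriv (p - q) (wderiv p - wderiv q)"
    by (rule weak_derivI[OF primitive_cong_AE[OF primitive_diff_fun[OF f(1) F(1)]] rep0])
      (use rep1 in \<open>eventually_elim, simp\<close>)
  have w2: "weak_deriv (wderiv p - wderiv q) (wderiv (wderiv p) - wderiv (wderiv q))"
  proof (rule weak_derivI[OF primitive_cong_AE[OF primitive_diff_fun[OF f(2) F(2)]] rep1])
    show "AE z in halfline. rep_l2 (wderiv (wderiv p)) z - rep_l2 (wderiv (wderiv q)) z =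
        rep_l2 (wderiv (wderiv p) - wderiv (wderiv q)) z"
      using AE_rep_diff[of "wderiv (wderiv p)" "wderiv (wderiv q)"] by eventually_elim simp
  qed
  show "wderiv (p - q) = wderiv p - wderiv q" using w1 by (rule wderiv_eq)
  then show "wderiv (wderiv (p - q)) = wderiv (wderiv p) - wderiv (wderiv q)"
    using w2 wderiv_eq by simp
  have "vanishes_at_0 (p - q)"
    unfolding vanishes_at_0_def
    using primitive_continuous[OF primitive_diff_fun[OF f(1) F(1)]] rep0 f(5) F(5)
    by (intro exI[of _ "\<lambda>z. f z - F z"]) auto
  with w1 w2 show "p - q \<in> dom_L" by (auto simp: dom_L_def H2_def)
qed

section \<open>Inverting the model operator\<close>

lemma tendsto_integral_halfline:
  fixes F :: "real \<Rightarrow> 'a::euclidean_space"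
  assumes "F absolutely_integrable_on {..0}"
  shows "(\<lambda>n. integral {- real n..0} F) \<longlonglongrightarrow> integral {..0} F"
proof -
  have F: "F absolutely_integrable_on {- real n..0}" for n
    by (rule absolutely_integrable_on_subinterval[OF assms]) auto
  have "(\<lambda>n. integral {..0} (\<lambda>z. if z \<in> {- real n..0} then F z else 0)) \<longlonglongrightarrow> integral {..0} F"
  proof (rule dominated_convergence(2))
    show "(\<lambda>z. if z \<in> {- real n..0} then F z else 0) integrable_on {..0}" for n
      by (subst integrable_restrict_Int)
        (use set_lebesgue_integral_eq_integral(1)[OF F[of n]] in \<open>simp add: Int_absorb2\<close>)
    show "(\<lambda>z. norm (F z)) integrable_on {..0}"
      using absolutely_integrable_norm[OF assms] by (auto simp: o_def dest: set_lebesgue_integral_eq_integral(1))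
    fix z :: real assume "z \<in> {..0}"
    show "(\<lambda>n. if z \<in> {- real n..0} then F z else 0) \<longlonglongrightarrow> F z"
    proof (rule tendsto_eventually)
      obtain N :: nat where "- z \<le> real N" using real_arch_simple by blast
      then show "\<forall>\<^sub>F n in sequentially. (if z \<in> {- real n..0} then F z else 0) = F z"
        using \<open>z \<in> {..0}\<close> by (auto simp: eventually_sequentially intro!: exI[of _ N])
    qed
  qed auto
  moreover have "integral {..0} (\<lambda>z. if z \<in> {- real n..0} then F z else 0) = integral {- real n..0} F" for n
    by (subst integral_restrict_Int) (simp add: Int_absorb2)
  ultimately show ?thesis by simp
qed

text \<open>
  Square integrability of solutions is read off from energy bounds on compact intervals; the approximants
  \<open>F n\<close> need to satisfy such a bound on \<open>[-n,0]\<close> only.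
\<close>

lemma square_intI_Fatou:
  fixes f :: "real \<Rightarrow> complex"
  assumes f: "continuous_on {..0} f"
    and c: "\<And>n. continuous_on {..0} (F n)"
    and lim: "\<And>z. z \<le> 0 \<Longrightarrow> (\<lambda>n. F n z) \<longlonglongrightarrow> f z"
    and bound: "\<And>n. integral {- real n..0} (\<lambda>z. (cmod (F n z))\<^sup>2) \<le> C"
  shows "square_int f"
  unfolding square_int_def
proof (intro conjI integrableI_bounded)
  show m: "f \<in> borel_measurable halfline" by (rule halfline_measurable[OF f])
  then show "(\<lambda>z. (cmod (f z))\<^sup>2) \<in> borel_measurable halfline" by measurable
  define G where "G n z = (if z \<in> {- real n..0} then (cmod (F n z))\<^sup>2 else 0)" for n z
  have int: "integrable halfline (G n)" "(LINT z|halfline. G n z) = integral {- real n..0} (\<lambda>z. (cmod (F n z))\<^sup>2)" for n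
  proof -
    have c': "continuous_on {- real n..0} (\<lambda>z. (cmod (F n z))\<^sup>2)"
      by (intro continuous_intros continuous_on_subset[OF c]) auto
    have "G n absolutely_integrable_on {- real n..0}"
      by (rule absolutely_integrable_spike[OF absolutely_integrable_continuous_real[OF c'] negligible_empty])
        (simp add: G_def)
    note T = truncated_halfline_integral[OF this]
    show "integrable halfline (G n)" by (rule T(1)) (simp add: G_def)
    have "(LINT z|halfline. G n z) = integral {- real n..0} (G n)" by (rule T(2)) (simp add: G_def)
    also have "\<dots> = integral {- real n..0} (\<lambda>z. (cmod (F n z))\<^sup>2)"
      by (rule integral_cong) (simp add: G_def)
    finally show "(LINT z|halfline. G n z) = integral {- real n..0} (\<lambda>z. (cmod (F n z))\<^sup>2)" .
  qed
  have Gm: "G n \<in> borel_measurable halfline" for n using int(1) by (rule borel_measurable_integrable)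
  have nn: "(\<integral>\<^sup>+z. ennreal (G n z) \<partial>halfline) \<le> ennreal C" for n
  proof -
    have "(\<integral>\<^sup>+z. ennreal (G n z) \<partial>halfline) = ennreal (LINT z|halfline. G n z)"
      by (rule nn_integral_eq_integral[OF int(1)]) (simp add: G_def)
    then show ?thesis using bound[of n] int(2)[of n] by (simp add: ennreal_leI)
  qed
  have "(\<integral>\<^sup>+z. ennreal (norm ((cmod (f z))\<^sup>2)) \<partial>halfline) = (\<integral>\<^sup>+z. liminf (\<lambda>n. ennreal (G n z)) \<partial>halfline)"
  proof (rule nn_integral_cong)
    fix z assume "z \<in> space halfline"
    then have z: "z < 0" by simp
    obtain N :: nat where N: "- z \<le> real N" using real_arch_simple by blast
    have ev: "\<forall>\<^sub>F n in sequentially. (cmod (F n z))\<^sup>2 = G n z"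
      using z N by (auto simp: G_def eventually_sequentially intro!: exI[of _ N])
    have "(\<lambda>n. (cmod (F n z))\<^sup>2) \<longlonglongrightarrow> (cmod (f z))\<^sup>2" using lim[of z] z by (intro tendsto_intros) auto
    then have "(\<lambda>n. G n z) \<longlonglongrightarrow> (cmod (f z))\<^sup>2" using ev by (rule Lim_transform_eventually)
    then have "(\<lambda>n. ennreal (G n z)) \<longlonglongrightarrow> ennreal ((cmod (f z))\<^sup>2)" by (intro tendsto_intros)
    from lim_imp_Liminf[OF trivial_limit_sequentially this]
    show "ennreal (norm ((cmod (f z))\<^sup>2)) = liminf (\<lambda>n. ennreal (G n z))" by simp
  qed
  also have "\<dots> \<le> liminf (\<lambda>n. \<integral>\<^sup>+z. ennreal (G n z) \<partial>halfline)"
    by (rule nn_integral_liminf) (use Gm in measurable)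
  also have "\<dots> \<le> liminf (\<lambda>n. ennreal C)"
    by (rule Liminf_mono) (simp add: nn)
  also have "\<dots> < \<infinity>" by (simp add: Liminf_const)
  finally show "(\<integral>\<^sup>+z. ennreal (norm ((cmod (f z))\<^sup>2)) \<partial>halfline) < \<infinity>" .
qed

lemma integral_norm_square_le:
  assumes "square_int g"
  shows "(\<lambda>z. (cmod (g z))\<^sup>2) integrable_on {a..0}"
    "integral {a..0} (\<lambda>z. (cmod (g z))\<^sup>2) \<le> integral {..0} (\<lambda>z. (cmod (g z))\<^sup>2)"
proof -
  have i: "(\<lambda>z. (cmod (g z))\<^sup>2) absolutely_integrable_on {..0}"
    using assms by (simp add: square_int_def flip: halfline_integrable_iff)
  have j: "(\<lambda>z. (cmod (g z))\<^sup>2) absolutely_integrable_on {a..0}"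
    by (rule absolutely_integrable_on_subinterval[OF i]) auto
  show k: "(\<lambda>z. (cmod (g z))\<^sup>2) integrable_on {a..0}"
    using j by (rule set_lebesgue_integral_eq_integral(1))
  show "integral {a..0} (\<lambda>z. (cmod (g z))\<^sup>2) \<le> integral {..0} (\<lambda>z. (cmod (g z))\<^sup>2)"
    by (rule integral_subset_le[OF _ k]) (use i in \<open>auto dest: set_lebesgue_integral_eq_integral(1)\<close>)
qed

lemma primitive_norm_square:
  fixes f :: "real \<Rightarrow> 'a::euclidean_space"
  assumes "primitive f g"
  shows "primitive (\<lambda>z. (norm (f z))\<^sup>2) (\<lambda>z. 2 * (f z \<bullet> g z))"
  using primitive_bilinear[OF assms assms bounded_bilinear_inner]
  by (simp add: dot_square_norm inner_commute)

lemma young_inner: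
  fixes x y :: "'a::real_inner"
  assumes "a > 0"
  shows "2 * (x \<bullet> y) \<le> a * (norm x)\<^sup>2 + (norm y)\<^sup>2 / a"
proof -
  have "0 \<le> (norm (a *\<^sub>R x - y))\<^sup>2 / a" using assms by simp
  also have "\<dots> = a * (norm x)\<^sup>2 + (norm y)\<^sup>2 / a - 2 * (x \<bullet> y)"
    using assms by (simp add: power2_norm_eq_inner inner_diff field_simps inner_commute)
  finally show ?thesis by simp
qed

lemma primitive_exp: "primitive (\<lambda>z. exp (k * z)) (\<lambda>z. k * exp (k * z))"
  by (rule primitive_of_deriv)
    (auto intro!: derivative_eq_intros continuous_intros simp flip: has_real_derivative_iff_has_vector_derivative)

lemma abs_int_exp_mult:
  assumes "square_int g"
  shows "(\<lambda>z. exp (k * z) *\<^sub>R g z) absolutely_integrable_on {a..0}"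
proof (rule absolutely_integrable_bounded_measurable_product[where h = "(*\<^sub>R)" and f = "\<lambda>z. exp (k * z)",
    OF _ _ _ _ square_int_abs_int[OF assms order_refl]])
  have c: "continuous_on {a..0} (\<lambda>z. exp (k * z))" by (intro continuous_intros)
  show "(\<lambda>z. exp (k * z)) \<in> borel_measurable (lebesgue_on {a..0})"
    by (rule continuous_imp_measurable_on_sets_lebesgue[OF c]) auto
  show "bounded ((\<lambda>z. exp (k * z)) ` {a..0})"
    by (rule compact_imp_bounded[OF compact_continuous_image[OF c]]) auto
  show "bilinear ((*\<^sub>R) :: real \<Rightarrow> complex \<Rightarrow> complex)"
    using bounded_bilinear_scaleR bilinear_conv_bounded_bilinear by blast
qed auto

lemma primitive_exp_mult:
  fixes Q :: "real \<Rightarrow> complex"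
  assumes "primitive Q (\<lambda>z. exp (- k * z) *\<^sub>R g z)"
  shows "primitive (\<lambda>z. exp (k * z) *\<^sub>R Q z) (\<lambda>z. g z + k *\<^sub>R (exp (k * z) *\<^sub>R Q z))"
  using primitive_bilinear[OF primitive_exp[of k] assms bounded_bilinear_scaleR]
  by (simp flip: exp_add)

text \<open>
  The solution of \<open>q' + a q = g\<close> is \<open>q(z) = e\<^bsup>-az\<^esup> \<integral>\<^bsub>(-\<infinity>,z]\<^esub> e\<^bsup>as\<^esup> g(s) ds\<close>. It is approximated by
  the solutions vanishing at \<open>-n\<close>, for which the energy balance
  \<open>0 \<le> |q(0)|\<^sup>2 - |q(-n)|\<^sup>2 = \<integral> 2 q \<bullet> (g - a q) \<le> \<integral> |g|\<^sup>2/a - a |q|\<^sup>2\<close> bounds the \<open>L\<^sup>2\<close> norm independently of \<open>n\<close>.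
\<close>

lemma decaying_solution:
  fixes g :: "real \<Rightarrow> complex"
  assumes a: "a > 0" and g: "square_int g"
  obtains q where "primitive q (\<lambda>z. g z - a *\<^sub>R q z)" "square_int q"
proof -
  define k where "k z = exp (a * z) *\<^sub>R g z" for z
  have exp_sq: "square_int (\<lambda>z. complex_of_real (exp (a * z)))"
  proof (rule square_intI_Fatou[where F = "\<lambda>n z. complex_of_real (exp (a * z))"])
    fix n :: nat
    have "integral {- real n..0} (\<lambda>z. (cmod (complex_of_real (exp (a * z))))\<^sup>2)
        = integral {- real n..0} (\<lambda>z. (1 / (2 * a)) *\<^sub>R (2 * a * exp (2 * a * z)))"
      by (rule integral_cong) (use a in \<open>simp add: power2_eq_square flip: exp_add\<close>)
    also have "\<dots> = (1 / (2 * a)) *\<^sub>R integral {- real n..0} (\<lambda>z. 2 * a * exp (2 * a * z))"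
      by (rule integral_cmul)
    also have "\<dots> = (1 / (2 * a)) * (1 - exp (2 * a * - real n))"
      using primitive_diff[OF primitive_exp[of "2 * a"], of "- real n" 0] by simp
    also have "\<dots> \<le> 1 / (2 * a)" using a by (simp add: field_simps)
    finally show "integral {- real n..0} (\<lambda>z. (cmod (complex_of_real (exp (a * z))))\<^sup>2) \<le> 1 / (2 * a)" .
  qed (auto intro!: continuous_intros)
  have km: "integrable halfline k"
  proof (rule Bochner_Integration.integrable_bound)
    show "integrable halfline (\<lambda>z. (cmod (complex_of_real (exp (a * z))))\<^sup>2 + (cmod (g z))\<^sup>2)"
      using exp_sq g by (auto simp: square_int_def)
    have "(\<lambda>z. exp (a * z)) \<in> borel_measurable halfline"
      by (rule halfline_measurable) (intro continuous_intros)
    moreover have "g \<in> borel_measurable halfline" using g by (simp add: square_int_def)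
    ultimately show "k \<in> borel_measurable halfline" unfolding k_def by measurable
    show "AE z in halfline. norm (k z) \<le> norm ((cmod (complex_of_real (exp (a * z))))\<^sup>2 + (cmod (g z))\<^sup>2)"
    proof (rule AE_I2)
      fix z
      have "2 * (exp (a * z) * cmod (g z)) \<le> (exp (a * z))\<^sup>2 + (cmod (g z))\<^sup>2"
        using sum_squares_bound[of "exp (a * z)" "cmod (g z)"] by simp
      moreover have "0 \<le> exp (a * z) * cmod (g z)" by simp
      ultimately have "exp (a * z) * cmod (g z) \<le> (exp (a * z))\<^sup>2 + (cmod (g z))\<^sup>2" by linarith
      then show "norm (k z) \<le> norm ((cmod (complex_of_real (exp (a * z))))\<^sup>2 + (cmod (g z))\<^sup>2)"
        by (simp add: k_def)
    qed
  qed
  then have ki: "k absolutely_integrable_on {..0}" by (simp add: halfline_integrable_iff)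
  define Q where "Q z = - integral {z..0} k + integral {..0} k" for z
  have Q: "primitive Q k"
    unfolding Q_def[abs_def]
    by (intro primitive_add_const ex_primitive absolutely_integrable_on_subinterval[OF ki]) auto
  have Qlim: "(\<lambda>n. Q (- real n)) \<longlonglongrightarrow> 0"
    unfolding Q_def
    using tendsto_add[OF tendsto_minus[OF tendsto_integral_halfline[OF ki]] tendsto_const[of "integral {..0} k"]]
    by simp
  \<comment> \<open>The constant \<open>C = - Q (- n)\<close> selects the solution that vanishes at \<open>-n\<close>; \<open>C = 0\<close> selects the square-integrable one.\<close>
  define q where "q C z = exp (- a * z) *\<^sub>R (Q z + C)" for C z
  have q: "primitive (q C) (\<lambda>z. g z - a *\<^sub>R q C z)" for C
    using primitive_exp_mult[of "\<lambda>z. Q z + C" "- a" g] primitive_add_const[OF Q, of C]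
    by (simp add: q_def[abs_def] k_def[abs_def])
  show ?thesis
  proof (rule that[of "q 0"])
    show "primitive (q 0) (\<lambda>z. g z - a *\<^sub>R q 0 z)" by (rule q)
    let ?I = "integral {..0} (\<lambda>z. (cmod (g z))\<^sup>2)"
    show "square_int (q 0)"
    proof (rule square_intI_Fatou[where F = "\<lambda>n. q (- Q (- real n))" and C = "?I / a\<^sup>2"])
      show "continuous_on {..0} (q 0)" "continuous_on {..0} (q (- Q (- real n)))" for n
        by (rule primitive_continuous[OF q])+
      show "(\<lambda>n. q (- Q (- real n)) z) \<longlonglongrightarrow> q 0 z" for z
        unfolding q_def using Qlim by (auto intro!: tendsto_eq_intros)
      fix n :: nat
      let ?q = "q (- Q (- real n))"
      have i1: "(\<lambda>z. (cmod (?q z))\<^sup>2) integrable_on {- real n..0}"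
        by (intro integrable_continuous_real continuous_intros primitive_continuous_Icc[OF q]) simp
      have i2: "(\<lambda>z. (cmod (g z))\<^sup>2 / a) integrable_on {- real n..0}"
        using integral_norm_square_le(1)[OF g] by (rule integrable_on_divide)
      have "0 \<le> (cmod (?q 0))\<^sup>2 - (cmod (?q (- real n)))\<^sup>2" by (simp add: q_def)
      also have "\<dots> = integral {- real n..0} (\<lambda>z. 2 * (?q z \<bullet> (g z - a *\<^sub>R ?q z)))"
        by (rule primitive_diff[OF primitive_norm_square[OF q]]) auto
      also have "\<dots> \<le> integral {- real n..0} (\<lambda>z. (cmod (g z))\<^sup>2 / a - a * (cmod (?q z))\<^sup>2)"
      proof (rule integral_le)
        show "(\<lambda>z. 2 * (?q z \<bullet> (g z - a *\<^sub>R ?q z))) integrable_on {- real n..0}"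
          by (rule primitive_int[OF primitive_norm_square[OF q]]) simp
        show "(\<lambda>z. (cmod (g z))\<^sup>2 / a - a * (cmod (?q z))\<^sup>2) integrable_on {- real n..0}"
          by (intro Henstock_Kurzweil_Integration.integrable_diff i2 integrable_on_mult_right i1)
        fix z
        show "2 * (?q z \<bullet> (g z - a *\<^sub>R ?q z)) \<le> (cmod (g z))\<^sup>2 / a - a * (cmod (?q z))\<^sup>2"
          using young_inner[OF a, of "?q z" "g z"] by (simp add: inner_diff_right dot_square_norm)
      qed
      also have "\<dots> = integral {- real n..0} (\<lambda>z. (cmod (g z))\<^sup>2) / a - a * integral {- real n..0} (\<lambda>z. (cmod (?q z))\<^sup>2)"
        using Henstock_Kurzweil_Integration.integral_diff[OF i2 integrable_on_mult_right[OF i1, of a]] by simp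
      also have "\<dots> \<le> ?I / a - a * integral {- real n..0} (\<lambda>z. (cmod (?q z))\<^sup>2)"
        using integral_norm_square_le(2)[OF g, of "- real n"] a by (simp add: divide_right_mono)
      finally show "integral {- real n..0} (\<lambda>z. (cmod (?q z))\<^sup>2) \<le> ?I / a\<^sup>2"
        using a by (simp add: field_simps power2_eq_square)
    qed
  qed
qed

text \<open>
  For \<open>p' - b p = q\<close> with \<open>b > 0\<close> the homogeneous solutions are square integrable, so the value at 0 can be
  prescribed. The energy balance on \<open>[-n,0]\<close> now uses \<open>p(0) = 0\<close> instead of a condition at \<open>-n\<close>.
\<close>

lemma solution_vanishing_at_0:
  fixes q :: "real \<Rightarrow> complex"
  assumes b: "b > 0" and q: "square_int q"
  obtains p where "primitive p (\<lambda>z. q z + b *\<^sub>R p z)" "square_int p" "p 0 = 0"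
proof -
  define p where "p z = exp (b * z) *\<^sub>R (- integral {z..0} (\<lambda>z. exp (- b * z) *\<^sub>R q z))" for z
  have p: "primitive p (\<lambda>z. q z + b *\<^sub>R p z)"
    unfolding p_def by (rule primitive_exp_mult[OF ex_primitive[OF abs_int_exp_mult[OF q]]])
  have p0: "p 0 = 0" by (simp add: p_def)
  let ?I = "integral {..0} (\<lambda>z. (cmod (q z))\<^sup>2)"
  have "square_int p"
  proof (rule square_intI_Fatou[where F = "\<lambda>n. p" and C = "?I / b\<^sup>2"])
    show "continuous_on {..0} p" by (rule primitive_continuous[OF p])
    then show "continuous_on {..0} p" .
    fix n :: nat
    have i1: "(\<lambda>z. (cmod (p z))\<^sup>2) integrable_on {- real n..0}"
      by (intro integrable_continuous_real continuous_intros primitive_continuous_Icc[OF p]) simp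
    have i2: "(\<lambda>z. (cmod (q z))\<^sup>2 / b) integrable_on {- real n..0}"
      using integral_norm_square_le(1)[OF q] by (rule integrable_on_divide)
    have "b * integral {- real n..0} (\<lambda>z. (cmod (p z))\<^sup>2) - ?I / b
        \<le> b * integral {- real n..0} (\<lambda>z. (cmod (p z))\<^sup>2) - integral {- real n..0} (\<lambda>z. (cmod (q z))\<^sup>2) / b"
      using integral_norm_square_le(2)[OF q, of "- real n"] b by (simp add: divide_right_mono)
    also have "\<dots> = integral {- real n..0} (\<lambda>z. b * (cmod (p z))\<^sup>2 - (cmod (q z))\<^sup>2 / b)"
      using Henstock_Kurzweil_Integration.integral_diff[OF integrable_on_mult_right[OF i1, of b] i2] by simp
    also have "\<dots> \<le> integral {- real n..0} (\<lambda>z. 2 * (p z \<bullet> (q z + b *\<^sub>R p z)))"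
    proof (rule integral_le)
      show "(\<lambda>z. 2 * (p z \<bullet> (q z + b *\<^sub>R p z))) integrable_on {- real n..0}"
        by (rule primitive_int[OF primitive_norm_square[OF p]]) simp
      show "(\<lambda>z. b * (cmod (p z))\<^sup>2 - (cmod (q z))\<^sup>2 / b) integrable_on {- real n..0}"
        by (intro Henstock_Kurzweil_Integration.integrable_diff i2 integrable_on_mult_right i1)
      fix z
      show "b * (cmod (p z))\<^sup>2 - (cmod (q z))\<^sup>2 / b \<le> 2 * (p z \<bullet> (q z + b *\<^sub>R p z))"
        using young_inner[OF b, of "- p z" "q z"] by (simp add: inner_add_right dot_square_norm)
    qed
    also have "\<dots> = (cmod (p 0))\<^sup>2 - (cmod (p (- real n)))\<^sup>2"
      by (rule primitive_diff[OF primitive_norm_square[OF p], symmetric]) auto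
    also have "\<dots> \<le> 0" by (simp add: p0)
    finally show "integral {- real n..0} (\<lambda>z. (cmod (p z))\<^sup>2) \<le> ?I / b\<^sup>2"
      using b by (simp add: field_simps power2_eq_square)
  qed simp
  with p p0 show ?thesis using that by blast
qed

text \<open>
  With \<open>a b = 1\<close> and \<open>a - b = c\<close> one has \<open>\<partial>\<^sup>2 + c \<partial> - 1 = (\<partial> + a)(\<partial> - b)\<close>. The two factors are inverted one
  after the other; the boundary condition at 0 is imposed on the growing root only.
\<close>

lemma model_operator_surj:
  "\<exists>p\<in>dom_L. wderiv (wderiv p) + c *\<^sub>R wderiv p - p = G"
proof -
  define b where "b = (sqrt (c\<^sup>2 + 4) - c) / 2"
  define a where "a = b + c"
  have "\<bar>c\<bar> < sqrt (c\<^sup>2 + 4)" using real_sqrt_less_mono[of "c\<^sup>2" "c\<^sup>2 + 4"] by simp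
  then have ab: "a > 0" "b > 0" by (auto simp: a_def b_def field_simps)
  have prod: "a * b = 1"
    by (simp add: a_def b_def field_simps power2_eq_square[symmetric])
  obtain q where q: "primitive q (\<lambda>z. rep_l2 G z - a *\<^sub>R q z)" "square_int q"
    using decaying_solution[OF ab(1) square_int_rep[of G]] .
  obtain p where p: "primitive p (\<lambda>z. q z + b *\<^sub>R p z)" "square_int p" "p 0 = 0"
    using solution_vanishing_at_0[OF ab(2) q(2)] .
  let ?p' = "\<lambda>z. q z + b *\<^sub>R p z"
  let ?p'' = "\<lambda>z. (rep_l2 G z - a *\<^sub>R q z) + b *\<^sub>R ?p' z"
  have p': "primitive ?p' ?p''"
    by (rule primitive_add[OF q(1) primitive_linear[OF p(1) bounded_linear_scaleR_right]])
  have s': "square_int ?p'" by (intro square_int_add q(2) square_int_scaleR p(2))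
  have s'': "square_int ?p''"
    by (intro square_int_add square_int_diff square_int_scaleR square_int_rep q(2) p(2))
  note D = dom_L_memberI[OF p(1) p' p(2) s' s'' p(3)]
  have "wderiv (wderiv (abs_l2 p)) + c *\<^sub>R wderiv (abs_l2 p) - abs_l2 p = G"
    unfolding D(2,3) l2_eq_iff
    using AE_rep_diff[of "abs_l2 ?p'' + c *\<^sub>R abs_l2 ?p'" "abs_l2 p"]
      AE_rep_plus[of "abs_l2 ?p''" "c *\<^sub>R abs_l2 ?p'"] AE_rep_scaleR[of c "abs_l2 ?p'"]
      rep_abs_l2[OF p(2)] rep_abs_l2[OF s'] rep_abs_l2[OF s'']
  proof eventually_elim
    case (elim z)
    have "?p'' z + c *\<^sub>R ?p' z - p z = rep_l2 G z + (a * b - 1) *\<^sub>R p z"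
      by (simp add: a_def algebra_simps scaleR_conv_of_real prod)
    with elim prod show ?case by simp
  qed
  with D(1) show ?thesis by blast
qed


section \<open>A supersolution built from the profile\<close>

lemma bounded_on_halfline:
  fixes f :: "real \<Rightarrow> real"
  assumes f: "continuous_on {..0} f" and lim: "(f \<longlongrightarrow> l) at_bot"
  obtains C where "\<And>z. z \<le> 0 \<Longrightarrow> \<bar>f z\<bar> \<le> C"
proof -
  have "\<forall>\<^sub>F z in at_bot. dist (f z) l < 1" using lim by (rule tendstoD) simp
  then obtain N where N: "\<And>z. z \<le> N \<Longrightarrow> dist (f z) l < 1" by (auto simp: eventually_at_bot_linorder)
  have "compact (f ` {N..0})"
    by (rule compact_continuous_image[OF continuous_on_subset[OF f]]) auto
  then obtain B where B: "\<And>z. z \<in> {N..0} \<Longrightarrow> \<bar>f z\<bar> \<le> B"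
    using compact_imp_bounded by (fastforce simp: bounded_iff)
  show ?thesis
  proof (rule that[of "max B (\<bar>l\<bar> + 1)"])
    fix z :: real assume "z \<le> 0"
    then show "\<bar>f z\<bar> \<le> max B (\<bar>l\<bar> + 1)"
      using N[of z] B[of z] by (cases "z \<le> N") (auto simp: dist_real_def le_max_iff_disj)
  qed
qed

lemma spreading_profileD:
  assumes "spreading_profile c u"
  obtains v where
    "\<And>z. z \<le> 0 \<Longrightarrow> (u has_real_derivative v z) (at z within {..0})"
    "\<And>z. z \<le> 0 \<Longrightarrow> (v has_real_derivative - c * v z - u z * (1 - u z)) (at z within {..0})"
    "(v \<longlongrightarrow> 0) at_bot" "\<And>z. z \<le> 0 \<Longrightarrow> v z \<le> 0"
proof -
  obtain v where v: "\<And>z. z \<le> 0 \<Longrightarrow> (u has_real_derivative v z) (at z within {..0})"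
    "\<And>z. z \<le> 0 \<Longrightarrow> \<exists>w. (v has_real_derivative w) (at z within {..0}) \<and> w + c * v z + u z * (1 - u z) = 0"
    "(v \<longlongrightarrow> 0) at_bot"
    using assms unfolding spreading_profile_def by metis
  have anti: "antimono_on {..0} u" using assms by (simp add: spreading_profile_def)
  show ?thesis
  proof (rule that[OF v(1) _ v(3)])
    fix z :: real assume z: "z \<le> 0"
    obtain w where w: "(v has_real_derivative w) (at z within {..0})" "w + c * v z + u z * (1 - u z) = 0"
      using v(2)[OF z] by blast
    have "w = - c * v z - u z * (1 - u z)" using w(2) by linarith
    with w(1) show "(v has_real_derivative - c * v z - u z * (1 - u z)) (at z within {..0})" by simp
    show "v z \<le> 0"
    proof (rule ccontr)
      assume "\<not> v z \<le> 0"
      then obtain d where d: "d > 0" "\<And>h. h > 0 \<Longrightarrow> z - h \<in> {..0} \<Longrightarrow> h < d \<Longrightarrow> u (z - h) < u z"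
        using has_real_derivative_pos_inc_left[OF v(1)[OF z]] by (auto simp: not_le)
      have "u (z - d / 2) < u z" using d z by auto
      moreover have "u z \<le> u (z - d / 2)"
        using anti z d(1) by (auto simp: monotone_on_def)
      ultimately show False by simp
    qed
  qed
qed

text \<open>
  If \<open>v 0 = 0\<close>, the energy \<open>v\<^sup>2/2 + u\<^sup>2/2 - u\<^sup>3/3\<close>, which is positive wherever \<open>0 < u < 1\<close>, vanishes at 0.
  Friction makes it decrease in \<open>z\<close>, but at a rate of at most \<open>2c\<close> times itself, so its product with
  \<open>e\<^bsup>2cz\<^esup>\<close> is nondecreasing and hence nonpositive for all \<open>z \<le> 0\<close>. In the proof \<open>E\<close> is six times this
  product.
\<close>

lemma profile_slope_at_0_neg:
  assumes c: "0 \<le> c" and sp: "spreading_profile c u"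
    and du: "\<And>z. z \<le> 0 \<Longrightarrow> (u has_real_derivative v z) (at z within {..0})"
    and dv: "\<And>z. z \<le> 0 \<Longrightarrow> (v has_real_derivative - c * v z - u z * (1 - u z)) (at z within {..0})"
    and neg: "v 0 \<le> 0"
  shows "v 0 < 0"
proof (rule ccontr)
  assume "\<not> v 0 < 0"
  with neg have v0: "v 0 = 0" by simp
  have u0: "u 0 = 0" and u1: "0 < u (-1)" and range: "\<And>z. z \<le> 0 \<Longrightarrow> 0 \<le> u z \<and> u z < 1"
    using sp by (auto simp: spreading_profile_def image_subset_iff)
  have cu: "continuous_on {..0} u" by (rule DERIV_continuous_on[OF du]) simp
  define E where "E z = exp (2 * c * z) * (3 * (v z * v z) + 3 * (u z * u z) - 2 * (u z * u z * u z))" for z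
  define E' where "E' z = exp (2 * c * z) * (2 * c * (u z)\<^sup>2 * (3 - 2 * u z))" for z
  have "primitive E E'"
  proof (rule primitive_of_deriv)
    show "continuous_on {..0} E'" unfolding E'_def by (intro continuous_intros cu)
    fix z :: real assume z: "z \<le> 0"
    have "(E has_real_derivative E' z) (at z within {..0})"
      unfolding E_def[abs_def] E'_def
      by (rule derivative_eq_intros du[OF z] dv[OF z] refl)+
        (simp add: algebra_simps power2_eq_square power3_eq_cube)
    then show "(E has_vector_derivative E' z) (at z within {..0})"
      by (simp add: has_real_derivative_iff_has_vector_derivative)
  qed
  then have "E 0 - E (-1) = integral {-1..0} E'" "E' integrable_on {-1..0}"
    using primitive_diff[of E E' "-1" 0] primitive_int[of E E' 0 "-1"] by auto
  moreover have "E' z \<ge> 0" if "z \<in> {-1..0}" for z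
    unfolding E'_def using range[of z] that c by (intro mult_nonneg_nonneg) auto
  ultimately have "E (-1) \<le> E 0"
    using integral_nonneg[of E' "{-1..0}"] by simp
  moreover have "E 0 = 0" by (simp add: E_def v0 u0)
  moreover have "E (-1) > 0"
  proof -
    have "0 < (u (-1))\<^sup>2 * (3 - 2 * u (-1))" using u1 range[of "-1"] by simp
    then have "0 < 3 * (v (-1))\<^sup>2 + (u (-1))\<^sup>2 * (3 - 2 * u (-1))"
      by (intro add_nonneg_pos) auto
    then show ?thesis unfolding E_def
      by (intro mult_pos_pos) (auto simp: algebra_simps power2_eq_square power3_eq_cube)
  qed
  ultimately show False by simp
qed

lemma profile_continuous:
  assumes "spreading_profile c u"
  shows "continuous_on {..0} u"
proof -
  obtain v where du: "\<And>z. z \<le> 0 \<Longrightarrow> (u has_real_derivative v z) (at z within {..0})"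
    using spreading_profileD[OF assms] by metis
  then show ?thesis by (intro DERIV_continuous_on[OF du]) auto
qed

text \<open>
  The function is \<open>\<phi> = \<psi>'/\<psi>\<close> with \<open>\<psi> = u - u'\<close>. Adding \<open>-u'\<close>, a solution of the linearized equation, to \<open>u\<close>
  keeps \<open>\<psi>\<close> positive up to \<open>z = 0\<close>, so that \<open>\<phi>\<close> stays bounded there. The Riccati expression equals
  \<open>-(\<psi>'' + c \<psi>' + (1 - 2u) \<psi>)/\<psi> = u\<^sup>2/\<psi>\<close>, which degenerates at \<open>z = 0\<close> only.
\<close>

lemma profile_riccati_supersolution:
  assumes c: "0 \<le> c" and sp: "spreading_profile c u"
  obtains \<phi> \<phi>' K where
    "\<And>z. z \<le> 0 \<Longrightarrow> (\<phi> has_real_derivative \<phi>' z) (at z within {..0})"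
    "continuous_on {..0} \<phi>'" "\<And>z. z \<le> 0 \<Longrightarrow> \<bar>\<phi> z\<bar> \<le> K"
    "\<And>z. z \<le> 0 \<Longrightarrow> 0 \<le> 2 * u z - 1 - c * \<phi> z - \<phi>' z - (\<phi> z)\<^sup>2"
    "\<And>z. z < 0 \<Longrightarrow> 0 < 2 * u z - 1 - c * \<phi> z - \<phi>' z - (\<phi> z)\<^sup>2"
proof -
  obtain v where du: "\<And>z. z \<le> 0 \<Longrightarrow> (u has_real_derivative v z) (at z within {..0})"
    and dv: "\<And>z. z \<le> 0 \<Longrightarrow> (v has_real_derivative - c * v z - u z * (1 - u z)) (at z within {..0})"
    and vlim: "(v \<longlongrightarrow> 0) at_bot" and vneg: "\<And>z. z \<le> 0 \<Longrightarrow> v z \<le> 0"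
    by (rule spreading_profileD[OF sp]) (rule that)
  have u0: "u 0 = 0" and upos: "\<And>z. z < 0 \<Longrightarrow> 0 < u z" and ulim: "(u \<longlongrightarrow> 1) at_bot"
    using sp by (auto simp: spreading_profile_def)
  have cu: "continuous_on {..0} u" by (rule profile_continuous[OF sp])
  have cv: "continuous_on {..0} v" by (rule DERIV_continuous_on[OF dv]) simp
  define \<psi> where "\<psi> z = u z - v z" for z
  define \<theta> where "\<theta> z = (1 + c) * v z + u z * (1 - u z)" for z
  define \<theta>' where "\<theta>' z = (1 + c) * (- c * v z - u z * (1 - u z)) + v z * (1 - 2 * u z)" for z
  have \<psi>pos: "\<psi> z > 0" if "z \<le> 0" for z
    using upos[of z] vneg[OF that] profile_slope_at_0_neg[OF c sp du dv vneg] u0 that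
    by (cases "z = 0") (auto simp: \<psi>_def)
  have d\<psi>: "(\<psi> has_real_derivative \<theta> z) (at z within {..0})" if "z \<le> 0" for z
    unfolding \<psi>_def[abs_def] \<theta>_def
    by (rule derivative_eq_intros du[OF that] dv[OF that] refl)+ (simp add: algebra_simps)
  have d\<theta>: "(\<theta> has_real_derivative \<theta>' z) (at z within {..0})" if "z \<le> 0" for z
    unfolding \<theta>_def[abs_def] \<theta>'_def
    by (rule derivative_eq_intros du[OF that] dv[OF that] refl)+ (simp add: algebra_simps)
  have c\<psi>: "continuous_on {..0} \<psi>" and c\<theta>: "continuous_on {..0} \<theta>" and c\<theta>': "continuous_on {..0} \<theta>'"
    unfolding \<psi>_def \<theta>_def \<theta>'_def by (intro continuous_intros cu cv)+
  define \<phi> where "\<phi> z = \<theta> z / \<psi> z" for z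
  define \<phi>' where "\<phi>' z = (\<theta>' z * \<psi> z - \<theta> z * \<theta> z) / (\<psi> z * \<psi> z)" for z
  have nz: "\<forall>z\<in>{..0}. \<psi> z \<noteq> 0" using \<psi>pos by force
  have c\<phi>: "continuous_on {..0} \<phi>" unfolding \<phi>_def by (intro continuous_intros c\<theta> c\<psi> nz)
  have "(\<theta> \<longlongrightarrow> (1 + c) * 0 + 1 * (1 - 1)) at_bot" "(\<psi> \<longlongrightarrow> 1 - 0) at_bot"
    unfolding \<theta>_def \<psi>_def by (intro tendsto_intros ulim vlim)+
  then have "(\<phi> \<longlongrightarrow> ((1 + c) * 0 + 1 * (1 - 1)) / (1 - 0)) at_bot"
    unfolding \<phi>_def by (intro tendsto_divide) auto
  then obtain K where K: "\<And>z. z \<le> 0 \<Longrightarrow> \<bar>\<phi> z\<bar> \<le> K"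
    using bounded_on_halfline[OF c\<phi>] by blast
  have S: "2 * u z - 1 - c * \<phi> z - \<phi>' z - (\<phi> z)\<^sup>2 = (u z)\<^sup>2 / \<psi> z" if "z \<le> 0" for z
  proof -
    have "\<psi> z \<noteq> 0" using \<psi>pos[OF that] by simp
    then have \<phi>'eq: "\<phi>' z = \<theta>' z / \<psi> z - (\<phi> z)\<^sup>2"
      by (simp add: \<phi>'_def \<phi>_def field_simps power2_eq_square)
    have "\<psi> z * (2 * u z - 1) - c * \<theta> z - \<theta>' z = (u z)\<^sup>2"
      by (simp add: \<psi>_def \<theta>_def \<theta>'_def algebra_simps power2_eq_square)
    then show ?thesis
      unfolding \<phi>'eq using \<open>\<psi> z \<noteq> 0\<close> by (simp add: \<phi>_def field_simps)
  qed
  show ?thesis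
  proof (rule that[of \<phi> \<phi>' K])
    show "(\<phi> has_real_derivative \<phi>' z) (at z within {..0})" if "z \<le> 0" for z
      unfolding \<phi>_def[abs_def] \<phi>'_def
      using DERIV_divide[OF d\<theta>[OF that] d\<psi>[OF that]] \<psi>pos[OF that] by simp
    show "continuous_on {..0} \<phi>'"
      unfolding \<phi>'_def by (intro continuous_intros c\<theta> c\<theta>' c\<psi>) (use nz in auto)
    show "0 \<le> 2 * u z - 1 - c * \<phi> z - \<phi>' z - (\<phi> z)\<^sup>2" if "z \<le> 0" for z
      unfolding S[OF that] using \<psi>pos[OF that] by simp
    show "0 < 2 * u z - 1 - c * \<phi> z - \<phi>' z - (\<phi> z)\<^sup>2" if "z < 0" for z
    proof -
      have z: "z \<le> 0" using that by simp
      show ?thesis unfolding S[OF z] using \<psi>pos[OF z] upos[OF that] by simp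
    qed
  qed (rule K)
qed

lemma continuous_imp_ge_near_0:
  fixes f :: "real \<Rightarrow> real"
  assumes "continuous_on {..0} f" "f 0 > b"
  obtains l where "l < 0" "\<And>z. l \<le> z \<Longrightarrow> z \<le> 0 \<Longrightarrow> f z \<ge> b"
proof -
  obtain d where d: "d > 0" "\<And>z. z \<in> {..0} \<Longrightarrow> dist z 0 < d \<Longrightarrow> dist (f z) (f 0) < f 0 - b"
    using assms unfolding continuous_on_iff by (metis atMost_iff diff_gt_0_iff_gt order_refl)
  show ?thesis
  proof (rule that[of "- d / 2"])
    fix z assume "- d / 2 \<le> z" "z \<le> 0"
    then show "f z \<ge> b" using d(2)[of z] d(1) by (auto simp: dist_real_def)
  qed (use d in simp)
qed

text \<open>
  The last inequality is the pointwise form of coercivity, to be used with \<open>x = p'\<close> and \<open>y = p\<close>. The weight is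
  \<open>w = \<epsilon> + e\<^bsup>cz\<^esup>\<close>, and \<open>a\<close> is chosen such that the cross term becomes
  \<open>-2 (e\<^bsup>cz\<^esup> \<phi> + \<epsilon> \<eta>) (x \<bullet> y)\<close>, which completes the squares \<open>|x - \<phi> y|\<^sup>2\<close> and \<open>|x - \<eta> y|\<^sup>2\<close> separately. The remaining coefficient of
  \<open>|y|\<^sup>2\<close> is \<open>S + \<epsilon> G\<close>: here \<open>S > 0\<close> for \<open>z < 0\<close>, while \<open>G \<ge> 1/2\<close> outside a compact subset of \<open>(-\<infinity>,0)\<close>.
\<close>

lemma energy_multiplier:
  assumes c: "0 \<le> c" and sp: "spreading_profile c u"
  obtains w w' a a' :: "real \<Rightarrow> real" and \<delta> C where
    "\<And>z. z \<le> 0 \<Longrightarrow> (w has_real_derivative w' z) (at z within {..0})" "continuous_on {..0} w'"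
    "\<And>z. z \<le> 0 \<Longrightarrow> (a has_real_derivative a' z) (at z within {..0})" "continuous_on {..0} a'"
    "\<And>z. z \<le> 0 \<Longrightarrow> 0 \<le> w z \<and> w z \<le> C" "\<And>z. z \<le> 0 \<Longrightarrow> \<bar>a z\<bar> \<le> C" "\<delta> > 0"
    "\<And>z x y :: complex. z \<le> 0 \<Longrightarrow>
      \<delta> * (cmod y)\<^sup>2 \<le> w z * (cmod x)\<^sup>2 + (w' z - c * w z + 2 * a z) * (x \<bullet> y)
        + (a' z + w z * (2 * u z - 1)) * (cmod y)\<^sup>2"
proof -
  obtain \<phi> \<phi>' K where d\<phi>: "\<And>z. z \<le> 0 \<Longrightarrow> (\<phi> has_real_derivative \<phi>' z) (at z within {..0})"
    and c\<phi>': "continuous_on {..0} \<phi>'" and K: "\<And>z. z \<le> 0 \<Longrightarrow> \<bar>\<phi> z\<bar> \<le> K"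
    and S0: "\<And>z. z \<le> 0 \<Longrightarrow> 0 \<le> 2 * u z - 1 - c * \<phi> z - \<phi>' z - (\<phi> z)\<^sup>2"
    and S1: "\<And>z. z < 0 \<Longrightarrow> 0 < 2 * u z - 1 - c * \<phi> z - \<phi>' z - (\<phi> z)\<^sup>2"
    using profile_riccati_supersolution[OF c sp] by metis
  have cu: "continuous_on {..0} u" by (rule profile_continuous[OF sp])
  have c\<phi>: "continuous_on {..0} \<phi>" by (rule DERIV_continuous_on[OF d\<phi>]) simp
  have u0: "u 0 = 0" and ulim: "(u \<longlongrightarrow> 1) at_bot" using sp by (auto simp: spreading_profile_def)
  define S where "S z = exp (c * z) * (2 * u z - 1 - c * \<phi> z - \<phi>' z - (\<phi> z)\<^sup>2)" for z
  \<comment> \<open>The slope \<open>-3\<close> at 0 turns the value \<open>2 u 0 - 1 = -1\<close> of the potential into \<open>G 0 = 2\<close>; the factor \<open>exp z\<close> makes \<open>\<eta>\<close> and \<open>\<eta>'\<close> vanish at \<open>-\<infinity>\<close>.\<close>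
  define \<eta> where "\<eta> z = - 3 * z * exp z" for z :: real
  define \<eta>' where "\<eta>' z = - 3 * exp z - 3 * z * exp z" for z :: real
  define G where "G z = 2 * u z - 1 - \<eta>' z - (\<eta> z)\<^sup>2" for z
  have d\<eta>: "(\<eta> has_real_derivative \<eta>' z) (at z within A)" for z A
    unfolding \<eta>_def[abs_def] \<eta>'_def by (auto intro!: derivative_eq_intros)
  have c\<eta>: "continuous_on A \<eta>" "continuous_on A \<eta>'" for A
    unfolding \<eta>_def \<eta>'_def by (intro continuous_intros)+
  have cS: "continuous_on {..0} S" unfolding S_def by (intro continuous_intros cu c\<phi> c\<phi>')
  have cG: "continuous_on {..0} G" unfolding G_def by (intro continuous_intros cu c\<eta>)
  have e0: "(exp \<longlongrightarrow> (0::real)) at_bot" by (rule exp_at_bot)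
  have ze: "((\<lambda>z::real. z * exp z) \<longlongrightarrow> 0) at_bot"
  proof -
    have "((\<lambda>x::real. x ^ 1 / exp x) \<longlongrightarrow> 0) at_top" by (rule tendsto_power_div_exp_0)
    then have "((\<lambda>x::real. - (x ^ 1 / exp x)) \<longlongrightarrow> - 0) at_top" by (rule tendsto_minus)
    then have "((\<lambda>x::real. (- x) * exp (- x)) \<longlongrightarrow> 0) at_top" by (simp add: exp_minus field_simps)
    then show ?thesis by (simp add: filterlim_at_bot_mirror)
  qed
  have \<eta>lim: "(\<eta> \<longlongrightarrow> 0) at_bot" "(\<eta>' \<longlongrightarrow> 0) at_bot"
  proof -
    have "((\<lambda>z::real. - 3 * (z * exp z)) \<longlongrightarrow> - 3 * 0) at_bot" by (intro tendsto_intros ze)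
    then show "(\<eta> \<longlongrightarrow> 0) at_bot" by (simp add: \<eta>_def[abs_def] mult.assoc)
    have "((\<lambda>z::real. - 3 * exp z - 3 * (z * exp z)) \<longlongrightarrow> - 3 * 0 - 3 * 0) at_bot"
      by (intro tendsto_intros ze e0)
    then show "(\<eta>' \<longlongrightarrow> 0) at_bot" by (simp add: \<eta>'_def[abs_def] mult.assoc)
  qed
  have "(G \<longlongrightarrow> 2 * 1 - 1 - 0 - 0\<^sup>2) at_bot" unfolding G_def by (intro tendsto_intros ulim \<eta>lim)
  then have "\<forall>\<^sub>F z in at_bot. G z > 1 / 2" by (rule order_tendstoD) simp
  then obtain M where M: "\<And>z. z \<le> M \<Longrightarrow> G z > 1 / 2" by (auto simp: eventually_at_bot_linorder)
  have "G 0 > 1 / 2" by (simp add: G_def \<eta>'_def \<eta>_def u0)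
  then obtain l where l: "l < 0" "\<And>z. l \<le> z \<Longrightarrow> z \<le> 0 \<Longrightarrow> G z \<ge> 1 / 2"
    using continuous_imp_ge_near_0[OF cG] by blast
  define I where "I = {min M l..l}"
  have I: "compact I" "I \<noteq> {}" "I \<subseteq> {..<0}" using l(1) by (auto simp: I_def)
  have I0: "I \<subseteq> {..0}" using I(3) by auto
  obtain x0 where x0: "x0 \<in> I" "\<And>z. z \<in> I \<Longrightarrow> S x0 \<le> S z"
    using continuous_attains_inf[OF I(1,2) continuous_on_subset[OF cS I0]] by blast
  obtain x1 where x1: "x1 \<in> I" "\<And>z. z \<in> I \<Longrightarrow> G x1 \<le> G z"
    using continuous_attains_inf[OF I(1,2) continuous_on_subset[OF cG I0]] by blast
  define m where "m = S x0"
  have m: "m > 0" using S1[of x0] x0(1) I(3) by (auto simp: m_def S_def)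
  define \<epsilon> where "\<epsilon> = m / (2 * (\<bar>G x1\<bar> + 1))"
  have \<epsilon>: "\<epsilon> > 0" using m by (simp add: \<epsilon>_def)
  define \<delta> where "\<delta> = min (\<epsilon> / 2) (m / 2)"
  have \<delta>: "\<delta> > 0" using m \<epsilon> by (simp add: \<delta>_def)
  have pos: "\<delta> \<le> S z + \<epsilon> * G z" if z: "z \<le> 0" for z
  proof (cases "z \<in> I")
    case True
    have "\<epsilon> * \<bar>G x1\<bar> \<le> \<epsilon> * (\<bar>G x1\<bar> + 1)" using \<epsilon> by simp
    also have "\<dots> = m / 2" by (simp add: \<epsilon>_def field_simps)
    finally have "\<epsilon> * (- \<bar>G x1\<bar>) \<ge> - (m / 2)" by simp
    moreover have "\<epsilon> * (- \<bar>G x1\<bar>) \<le> \<epsilon> * G z" using \<epsilon> x1(2)[OF True] by (intro mult_left_mono) auto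
    ultimately show ?thesis using x0(2)[OF True] by (simp add: m_def \<delta>_def min_def split: if_splits)
  next
    case False
    then have "z < min M l \<or> l < z" by (auto simp: I_def)
    then have "G z \<ge> 1 / 2" using M[of z] l(2)[of z] z by auto
    then have "\<epsilon> / 2 \<le> \<epsilon> * G z" using \<epsilon> by (simp add: field_simps)
    moreover have "S z \<ge> 0" using S0[OF z] by (simp add: S_def)
    ultimately show ?thesis by (simp add: \<delta>_def)
  qed
  obtain K2 where K2: "\<And>z. z \<le> 0 \<Longrightarrow> \<bar>\<eta> z\<bar> \<le> K2"
    using bounded_on_halfline[OF c\<eta>(1) \<eta>lim(1)] by blast
  define w where "w z = \<epsilon> + exp (c * z)" for z
  define w' where "w' z = c * exp (c * z)" for z
  define a where "a z = c * \<epsilon> / 2 - (exp (c * z) * \<phi> z + \<epsilon> * \<eta> z)" for z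
  define a' where "a' z = - (c * exp (c * z) * \<phi> z + exp (c * z) * \<phi>' z + \<epsilon> * \<eta>' z)" for z
  have e1: "exp (c * z) \<le> 1" if "z \<le> 0" for z using c that by (simp add: mult_nonneg_nonpos)
  show ?thesis
  proof (rule that[of w w' a a' "\<epsilon> + 1 + c * \<epsilon> / 2 + (K + \<epsilon> * K2)" \<delta>])
    have K0: "0 \<le> K" "0 \<le> K2" using K[of 0] K2[of 0] by auto
    show "(w has_real_derivative w' z) (at z within {..0})" for z
      unfolding w_def[abs_def] w'_def by (auto intro!: derivative_eq_intros)
    show "continuous_on {..0} w'" unfolding w'_def by (intro continuous_intros)
    show "(a has_real_derivative a' z) (at z within {..0})" if "z \<le> 0" for z
      unfolding a_def[abs_def] a'_def
      by (rule derivative_eq_intros d\<phi>[OF that] d\<eta> refl)+ simp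
    show "continuous_on {..0} a'" unfolding a'_def by (intro continuous_intros c\<phi> c\<phi>' c\<eta>)
    show "0 \<le> w z \<and> w z \<le> \<epsilon> + 1 + c * \<epsilon> / 2 + (K + \<epsilon> * K2)" if "z \<le> 0" for z
      unfolding w_def using e1[OF that] c \<epsilon> K0 by (auto intro!: add_nonneg_nonneg add_increasing2)
    show "\<bar>a z\<bar> \<le> \<epsilon> + 1 + c * \<epsilon> / 2 + (K + \<epsilon> * K2)" if "z \<le> 0" for z
    proof -
      have "exp (c * z) * \<bar>\<phi> z\<bar> \<le> 1 * K" using e1[OF that] K[OF that] by (intro mult_mono) auto
      moreover have "\<epsilon> * \<bar>\<eta> z\<bar> \<le> \<epsilon> * K2" using K2[OF that] \<epsilon> by simp
      moreover have "\<bar>a z\<bar> \<le> c * \<epsilon> / 2 + (exp (c * z) * \<bar>\<phi> z\<bar> + \<epsilon> * \<bar>\<eta> z\<bar>)"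
      proof -
        have "\<bar>c * \<epsilon> / 2\<bar> = c * \<epsilon> / 2" using c \<epsilon> by simp
        moreover have "\<bar>exp (c * z) * \<phi> z\<bar> = exp (c * z) * \<bar>\<phi> z\<bar>" "\<bar>\<epsilon> * \<eta> z\<bar> = \<epsilon> * \<bar>\<eta> z\<bar>"
          using \<epsilon> by (auto simp: abs_mult)
        ultimately show ?thesis unfolding a_def by linarith
      qed
      ultimately show ?thesis using \<epsilon> by linarith
    qed
    fix z :: real and x y :: complex assume z: "z \<le> 0"
    have sq: "(cmod (x - k *\<^sub>R y))\<^sup>2 = (cmod x)\<^sup>2 - 2 * k * (x \<bullet> y) + k\<^sup>2 * (cmod y)\<^sup>2" for k
      unfolding power2_norm_eq_inner power2_eq_square[of k]
      by (simp add: inner_diff_left inner_diff_right inner_commute[of y x] algebra_simps)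
    have "\<delta> * (cmod y)\<^sup>2 \<le> (S z + \<epsilon> * G z) * (cmod y)\<^sup>2"
      by (rule mult_right_mono[OF pos[OF z]]) simp
    also have "\<dots> \<le> exp (c * z) * (cmod (x - \<phi> z *\<^sub>R y))\<^sup>2 + \<epsilon> * (cmod (x - \<eta> z *\<^sub>R y))\<^sup>2
        + (S z + \<epsilon> * G z) * (cmod y)\<^sup>2"
      using \<epsilon> by simp
    also have "\<dots> = w z * (cmod x)\<^sup>2 + (w' z - c * w z + 2 * a z) * (x \<bullet> y)
        + (a' z + w z * (2 * u z - 1)) * (cmod y)\<^sup>2"
      unfolding sq by (simp add: w_def w'_def a_def a'_def S_def G_def algebra_simps)
    finally show "\<delta> * (cmod y)\<^sup>2 \<le> w z * (cmod x)\<^sup>2 + (w' z - c * w z + 2 * a z) * (x \<bullet> y)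
        + (a' z + w z * (2 * u z - 1)) * (cmod y)\<^sup>2" .
  qed (rule \<delta>)
qed


section \<open>The energy estimate\<close>

lemma integrable_halfline_small_value:
  fixes F :: "real \<Rightarrow> real"
  assumes F: "F absolutely_integrable_on {..0}" and e: "e > 0" and N: "N \<ge> 0"
  obtains R where "R \<ge> N" "\<bar>F (- R)\<bar> < e"
proof -
  have Fa: "(\<lambda>z. \<bar>F z\<bar>) absolutely_integrable_on {..0}"
    using absolutely_integrable_norm[OF F] by (simp add: o_def)
  have Fi: "(\<lambda>z. \<bar>F z\<bar>) integrable_on {a..b}" if "b \<le> 0" for a b
    using that by (intro set_lebesgue_integral_eq_integral(1) absolutely_integrable_on_subinterval[OF Fa]) auto
  have "\<exists>R\<ge>N. \<bar>F (- R)\<bar> < e"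
  proof (rule ccontr)
    assume "\<not> ?thesis"
    then have ge: "e \<le> \<bar>F z\<bar>" if "z \<le> - N" for z
      using that by (metis le_minus_iff minus_minus not_less)
    obtain m :: nat where m: "integral {..0} (\<lambda>z. \<bar>F z\<bar>) < real m * e"
      using ex_less_of_nat_mult[OF e] by blast
    have "real m * e = integral {- N - real m..- N} (\<lambda>_. e)" by simp
    also have "\<dots> \<le> integral {- N - real m..- N} (\<lambda>z. \<bar>F z\<bar>)"
      by (rule integral_le[OF _ Fi]) (use ge N in auto)
    also have "\<dots> \<le> integral {..0} (\<lambda>z. \<bar>F z\<bar>)"
      by (rule integral_subset_le[OF _ Fi]) (use N set_lebesgue_integral_eq_integral(1)[OF Fa] in auto)
    finally show False using m by simp
  qed
  then show ?thesis using that by blast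
qed

lemma inner_mult_self: "(k * y) \<bullet> y = Re k * (cmod y)\<^sup>2" for k y :: complex
  unfolding inner_complex_def cmod_power2 by (simp add: algebra_simps power2_eq_square)

text \<open>
  The quantity \<open>F = w (f' \<bullet> f) + a |f|\<^sup>2\<close> satisfies \<open>F' \<ge> w (h \<bullet> f) + \<delta> |f|\<^sup>2\<close> by the choice of the multiplier. It vanishes
  at 0 and is integrable, hence small at points \<open>-R\<close> tending to \<open>-\<infinity>\<close>, and integrating over \<open>[-R,0]\<close> bounds
  \<open>\<integral> |f|\<^sup>2\<close>. The constant does not depend on \<open>P\<close>, which is what the method of continuity needs.
\<close>

lemma energy_estimate:
  assumes c: "0 \<le> c" and sp: "spreading_profile c u"
  shows "\<exists>K\<ge>0. \<forall>f g r P h. primitive f g \<longrightarrow> primitive g r \<longrightarrow> f 0 = 0 \<longrightarrow>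
      square_int f \<longrightarrow> square_int g \<longrightarrow> square_int h \<longrightarrow>
      (\<forall>z\<le>0. 2 * u z - 1 \<le> Re (P z)) \<longrightarrow>
      (AE z in halfline. r z = h z - c *\<^sub>R g z + P z * f z) \<longrightarrow>
      integral {..0} (\<lambda>z. (cmod (f z))\<^sup>2) \<le> K\<^sup>2 * integral {..0} (\<lambda>z. (cmod (h z))\<^sup>2)"
proof -
  obtain w w' a a' :: "real \<Rightarrow> real" and \<delta> C where
    dw: "\<And>z. z \<le> 0 \<Longrightarrow> (w has_real_derivative w' z) (at z within {..0})" "continuous_on {..0} w'"
    and da: "\<And>z. z \<le> 0 \<Longrightarrow> (a has_real_derivative a' z) (at z within {..0})" "continuous_on {..0} a'"
    and bw: "\<And>z. z \<le> 0 \<Longrightarrow> 0 \<le> w z \<and> w z \<le> C" and ba: "\<And>z. z \<le> 0 \<Longrightarrow> \<bar>a z\<bar> \<le> C" and \<delta>: "\<delta> > 0"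
    and key: "\<And>z x y :: complex. z \<le> 0 \<Longrightarrow>
      \<delta> * (cmod y)\<^sup>2 \<le> w z * (cmod x)\<^sup>2 + (w' z - c * w z + 2 * a z) * (x \<bullet> y)
        + (a' z + w z * (2 * u z - 1)) * (cmod y)\<^sup>2"
    by (rule energy_multiplier[OF c sp]) (rule that)
  have C: "C \<ge> 0" using bw[of 0] by simp
  have pw: "primitive w w'" by (rule primitive_of_deriv) (use dw in \<open>auto simp: has_real_derivative_iff_has_vector_derivative\<close>)
  have pa: "primitive a a'" by (rule primitive_of_deriv) (use da in \<open>auto simp: has_real_derivative_iff_has_vector_derivative\<close>)
  show ?thesis
  proof (intro exI[of _ "C / \<delta>"] conjI allI impI)
    show "0 \<le> C / \<delta>" using C \<delta> by simp
    fix f g r :: "real \<Rightarrow> complex" and P h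
    assume f: "primitive f g" and g0: "primitive g r" and f0: "f 0 = 0"
      and sf: "square_int f" and sg: "square_int g" and sh: "square_int h"
      and P: "\<forall>z\<le>0. 2 * u z - 1 \<le> Re (P z)"
      and r: "AE z in halfline. r z = h z - c *\<^sub>R g z + P z * f z"
    define \<rho> where "\<rho> z = h z - c *\<^sub>R g z + P z * f z" for z
    have g: "primitive g \<rho>" by (rule primitive_cong_AE[OF g0]) (use r in \<open>simp add: \<rho>_def\<close>)
    define F where "F z = w z * (g z \<bullet> f z) + a z * (cmod (f z))\<^sup>2" for z
    define F' where "F' z = (w z * (g z \<bullet> g z + \<rho> z \<bullet> f z) + w' z * (g z \<bullet> f z))
        + (a z * (2 * (f z \<bullet> g z)) + a' z * (cmod (f z))\<^sup>2)" for z
    have F: "primitive F F'"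
      unfolding F_def[abs_def] F'_def[abs_def]
      by (intro primitive_add primitive_bilinear[OF pw _ bounded_bilinear_mult]
          primitive_bilinear[OF pa _ bounded_bilinear_mult] primitive_bilinear[OF g f bounded_bilinear_inner]
          primitive_norm_square[OF f])
    have lower: "\<delta> / 2 * (cmod (f z))\<^sup>2 - C\<^sup>2 / (2 * \<delta>) * (cmod (h z))\<^sup>2 \<le> F' z" if z: "z \<le> 0" for z
    proof -
      have "w z * ((2 * u z - 1) * (cmod (f z))\<^sup>2) \<le> w z * (Re (P z) * (cmod (f z))\<^sup>2)"
        using bw[OF z] P z by (intro mult_left_mono mult_right_mono) auto
      then have "F' z \<ge> w z * (h z \<bullet> f z) + (w z * (cmod (g z))\<^sup>2 + (w' z - c * w z + 2 * a z) * (g z \<bullet> f z)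
          + (a' z + w z * (2 * u z - 1)) * (cmod (f z))\<^sup>2)"
        unfolding F'_def \<rho>_def inner_add_left inner_diff_left inner_scaleR_left inner_mult_self dot_square_norm
          inner_commute[of "f z" "g z"]
        by (simp add: algebra_simps)
      with key[OF z, of "f z" "g z"] have 1: "F' z \<ge> w z * (h z \<bullet> f z) + \<delta> * (cmod (f z))\<^sup>2" by linarith
      have "\<bar>w z * (h z \<bullet> f z)\<bar> \<le> C * (cmod (h z) * cmod (f z))"
        unfolding abs_mult using bw[OF z] Cauchy_Schwarz_ineq2[of "h z" "f z"] by (intro mult_mono) auto
      also have "\<dots> \<le> \<delta> / 2 * (cmod (f z))\<^sup>2 + C\<^sup>2 / (2 * \<delta>) * (cmod (h z))\<^sup>2"
        using young_inner[OF \<delta>, of "cmod (f z)" "C * cmod (h z)"] by (simp add: field_simps power_mult_distrib)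
      finally show ?thesis using 1 by linarith
    qed
    have Fint: "F absolutely_integrable_on {..0}"
      unfolding halfline_integrable_iff[symmetric]
    proof (rule Bochner_Integration.integrable_bound)
      show "integrable halfline (\<lambda>z. C * (cmod (g z))\<^sup>2 + 2 * C * (cmod (f z))\<^sup>2)"
        using sf sg by (auto simp: square_int_def)
      show "F \<in> borel_measurable halfline" by (rule halfline_measurable[OF primitive_continuous[OF F]])
      show "AE z in halfline. norm (F z) \<le> norm (C * (cmod (g z))\<^sup>2 + 2 * C * (cmod (f z))\<^sup>2)"
      proof (rule AE_I2)
        fix z assume "z \<in> space halfline"
        then have z: "z \<le> 0" by simp
        have "cmod (g z) * cmod (f z) \<le> (cmod (g z))\<^sup>2 + (cmod (f z))\<^sup>2"
          using sum_squares_bound[of "cmod (g z)" "cmod (f z)"]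
            mult_nonneg_nonneg[OF norm_ge_zero[of "g z"] norm_ge_zero[of "f z"]] by linarith
        then have "\<bar>g z \<bullet> f z\<bar> \<le> (cmod (g z))\<^sup>2 + (cmod (f z))\<^sup>2"
          using Cauchy_Schwarz_ineq2[of "g z" "f z"] by linarith
        then have "\<bar>w z * (g z \<bullet> f z)\<bar> \<le> C * ((cmod (g z))\<^sup>2 + (cmod (f z))\<^sup>2)"
          unfolding abs_mult using bw[OF z] by (intro mult_mono) auto
        moreover have "\<bar>a z * (cmod (f z))\<^sup>2\<bar> \<le> C * (cmod (f z))\<^sup>2"
          unfolding abs_mult using ba[OF z] by (intro mult_mono) auto
        ultimately have "\<bar>F z\<bar> \<le> C * (cmod (g z))\<^sup>2 + 2 * C * (cmod (f z))\<^sup>2"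
          unfolding F_def by (simp add: algebra_simps)
        then show "norm (F z) \<le> norm (C * (cmod (g z))\<^sup>2 + 2 * C * (cmod (f z))\<^sup>2)" by simp
      qed
    qed
    let ?H = "integral {..0} (\<lambda>z. (cmod (h z))\<^sup>2)"
    have trunc: "integral {- real n..0} (\<lambda>z. (cmod (f z))\<^sup>2) \<le> (C / \<delta>)\<^sup>2 * ?H" for n
    proof (rule field_le_epsilon)
      fix e :: real assume e: "e > 0"
      obtain R where R: "R \<ge> real n" "\<bar>F (- R)\<bar> < e * \<delta> / 2"
        using integrable_halfline_small_value[OF Fint, of "e * \<delta> / 2" "real n"] e \<delta> by auto
      have i1: "(\<lambda>z. \<delta> / 2 * (cmod (f z))\<^sup>2) integrable_on {- R..0}"
        and i2: "(\<lambda>z. C\<^sup>2 / (2 * \<delta>) * (cmod (h z))\<^sup>2) integrable_on {- R..0}"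
        by (rule integrable_on_mult_right[OF integral_norm_square_le(1)[OF sf]],
            rule integrable_on_mult_right[OF integral_norm_square_le(1)[OF sh]])
      have "\<delta> / 2 * integral {- R..0} (\<lambda>z. (cmod (f z))\<^sup>2) - C\<^sup>2 / (2 * \<delta>) * integral {- R..0} (\<lambda>z. (cmod (h z))\<^sup>2)
          = integral {- R..0} (\<lambda>z. \<delta> / 2 * (cmod (f z))\<^sup>2 - C\<^sup>2 / (2 * \<delta>) * (cmod (h z))\<^sup>2)"
        using Henstock_Kurzweil_Integration.integral_diff[OF i1 i2] by simp
      also have "\<dots> \<le> integral {- R..0} F'"
        by (rule integral_le[OF Henstock_Kurzweil_Integration.integrable_diff[OF i1 i2] primitive_int[OF F]])
          (use lower in auto)
      also have "\<dots> = F 0 - F (- R)"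
        by (rule primitive_diff[OF F, symmetric]) (use R(1) in auto)
      also have "\<dots> \<le> e * \<delta> / 2"
      proof -
        have "F 0 = 0" by (simp add: F_def f0)
        then show ?thesis using R(2) by linarith
      qed
      finally have "\<delta> / 2 * integral {- R..0} (\<lambda>z. (cmod (f z))\<^sup>2)
          \<le> C\<^sup>2 / (2 * \<delta>) * integral {- R..0} (\<lambda>z. (cmod (h z))\<^sup>2) + e * \<delta> / 2" by simp
      also have "\<dots> \<le> C\<^sup>2 / (2 * \<delta>) * ?H + e * \<delta> / 2"
        using integral_norm_square_le(2)[OF sh, of "- R"] \<delta> by (intro add_right_mono mult_left_mono) auto
      finally have "integral {- R..0} (\<lambda>z. (cmod (f z))\<^sup>2) \<le> (C / \<delta>)\<^sup>2 * ?H + e"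
        using \<delta> by (simp add: field_simps power2_eq_square)
      moreover have "integral {- real n..0} (\<lambda>z. (cmod (f z))\<^sup>2) \<le> integral {- R..0} (\<lambda>z. (cmod (f z))\<^sup>2)"
        by (rule integral_subset_le[OF _ integral_norm_square_le(1)[OF sf] integral_norm_square_le(1)[OF sf]])
          (use R(1) in auto)
      ultimately show "integral {- real n..0} (\<lambda>z. (cmod (f z))\<^sup>2) \<le> (C / \<delta>)\<^sup>2 * ?H + e" by simp
    qed
    have "(\<lambda>z. (cmod (f z))\<^sup>2) absolutely_integrable_on {..0}"
      using sf by (simp add: square_int_def flip: halfline_integrable_iff)
    from tendsto_integral_halfline[OF this]
    show "integral {..0} (\<lambda>z. (cmod (f z))\<^sup>2) \<le> (C / \<delta>)\<^sup>2 * ?H"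
      by (rule LIMSEQ_le_const2) (use trunc in blast)
  qed
qed

section \<open>From the estimate to the spectrum\<close>

text \<open>
  Solvability of \<open>T + t B\<close> implies solvability of \<open>T + (t + s) B\<close> as soon as \<open>s K M \<le> 1/2\<close>, because
  \<open>x = (T + t B)\<^sup>-\<^sup>1 (g - s B x)\<close> is then a fixed point equation for a contraction. The a priori
  bound \<open>K\<close> is the same for all \<open>t\<close>, so finitely many steps lead from 0 to 1.
\<close>

lemma method_of_continuity:
  fixes T B :: "'a::real_normed_vector \<Rightarrow> 'a"
  assumes complete: "complete (UNIV :: 'a set)"
    and D: "\<And>p q. p \<in> D \<Longrightarrow> q \<in> D \<Longrightarrow> p - q \<in> D"
    and T: "\<And>p q. p \<in> D \<Longrightarrow> q \<in> D \<Longrightarrow> T (p - q) = T p - T q"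
    and B: "\<And>p q. B (p - q) = B p - B q" and M: "\<And>p. norm (B p) \<le> M * norm p"
    and K: "\<And>t p. 0 \<le> t \<Longrightarrow> t \<le> 1 \<Longrightarrow> p \<in> D \<Longrightarrow> norm p \<le> K * norm (T p + t *\<^sub>R B p)"
    and surj: "\<And>g. \<exists>p\<in>D. T p = g"
  shows "\<exists>p\<in>D. T p + B p = g"
proof -
  obtain N :: nat where N: "2 * (\<bar>K\<bar> * \<bar>M\<bar>) + 1 < real N" using reals_Archimedean2 by blast
  then have N0: "real N > 0" by (smt (verit) abs_ge_zero mult_nonneg_nonneg)
  define s where "s = 1 / real N"
  have step: "\<bar>K\<bar> * (s * \<bar>M\<bar>) \<le> 1 / 2" and s: "s > 0" using N N0 by (auto simp: s_def field_simps)
  have "\<forall>g. \<exists>p\<in>D. T p + (real k * s) *\<^sub>R B p = g" if "k \<le> N" for k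
    using that
  proof (induction k)
    case 0
    then show ?case using surj by simp
  next
    case (Suc k)
    let ?t = "real k * s"
    have t: "0 \<le> ?t" "?t \<le> 1" using Suc.prems N0 by (auto simp: s_def field_simps)
    obtain S where S: "\<And>g. S g \<in> D" "\<And>g. T (S g) + ?t *\<^sub>R B (S g) = g"
      using Suc by (metis Suc_leD)
    have Slip: "norm (S g - S h) \<le> \<bar>K\<bar> * norm (g - h)" for g h
    proof -
      have "T (S g - S h) + ?t *\<^sub>R B (S g - S h)
          = (T (S g) + ?t *\<^sub>R B (S g)) - (T (S h) + ?t *\<^sub>R B (S h))"
        by (simp add: T[OF S(1) S(1)] B scaleR_diff_right)
      then have eq: "T (S g - S h) + ?t *\<^sub>R B (S g - S h) = g - h"
        by (simp only: S(2))
      have "norm (S g - S h) \<le> K * norm (g - h)"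
        using K[OF t D[OF S(1) S(1)], of g h] eq by simp
      also have "\<dots> \<le> \<bar>K\<bar> * norm (g - h)" by (intro mult_right_mono) auto
      finally show ?thesis .
    qed
    show ?case
    proof
      fix g
      have "\<exists>!x. x \<in> UNIV \<and> S (g - s *\<^sub>R B x) = x"
      proof (rule Banach_fix[OF complete])
        fix x y :: 'a
        have "norm (S (g - s *\<^sub>R B x) - S (g - s *\<^sub>R B y)) \<le> \<bar>K\<bar> * norm (s *\<^sub>R B (y - x))"
          using Slip[of "g - s *\<^sub>R B x" "g - s *\<^sub>R B y"] by (simp add: B scaleR_diff_right)
        also have "\<dots> \<le> \<bar>K\<bar> * (s * (\<bar>M\<bar> * norm (y - x)))"
        proof -
          have "norm (B (y - x)) \<le> \<bar>M\<bar> * norm (y - x)"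
            using M[of "y - x"] by (rule order_trans) (intro mult_right_mono, auto)
          then show ?thesis using s by (auto intro!: mult_left_mono)
        qed
        also have "\<dots> = \<bar>K\<bar> * (s * \<bar>M\<bar>) * norm (x - y)" by (simp add: norm_minus_commute)
        also have "\<dots> \<le> 1 / 2 * norm (x - y)" using step by (intro mult_right_mono) auto
        finally show "dist (S (g - s *\<^sub>R B x)) (S (g - s *\<^sub>R B y)) \<le> 1 / 2 * dist x y"
          by (simp add: dist_norm)
      qed auto
      then obtain x where x: "S (g - s *\<^sub>R B x) = x" by blast
      have "x \<in> D" "T x + ?t *\<^sub>R B x = g - s *\<^sub>R B x"
        using S(1)[of "g - s *\<^sub>R B x"] S(2)[of "g - s *\<^sub>R B x"] x by auto
      then show "\<exists>p\<in>D. T p + (real (Suc k) * s) *\<^sub>R B p = g"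
        by (intro bexI[of _ x]) (auto simp: algebra_simps)
    qed
  qed
  from this[of N] show ?thesis using N0 by (simp add: s_def)
qed

lemma norm_l2_le:
  assumes "AE z in halfline. cmod (rep_l2 q z) \<le> C * cmod (rep_l2 p z)" "C \<ge> 0"
  shows "norm q \<le> C * norm p"
proof -
  have i: "integrable halfline (\<lambda>z. (cmod (rep_l2 p z))\<^sup>2)" for p
    using square_int_rep[of p] by (simp add: square_int_def)
  have "(LINT z|halfline. (cmod (rep_l2 q z))\<^sup>2) \<le> (LINT z|halfline. C\<^sup>2 * (cmod (rep_l2 p z))\<^sup>2)"
  proof (rule integral_mono_AE[OF i])
    show "integrable halfline (\<lambda>z. C\<^sup>2 * (cmod (rep_l2 p z))\<^sup>2)" using i by simp
    show "AE z in halfline. (cmod (rep_l2 q z))\<^sup>2 \<le> C\<^sup>2 * (cmod (rep_l2 p z))\<^sup>2"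
      using assms(1)
    proof eventually_elim
      case (elim z)
      then have "(cmod (rep_l2 q z))\<^sup>2 \<le> (C * cmod (rep_l2 p z))\<^sup>2" by (rule power_mono) simp
      then show ?case by (simp add: power_mult_distrib)
    qed
  qed
  then have "(norm q)\<^sup>2 \<le> (C * norm p)\<^sup>2"
    by (simp add: norm_l2_eq power_mult_distrib)
  then show ?thesis by (rule power2_le_imp_le) (use assms(2) in simp)
qed

text \<open>
  Here \<open>L - \<mu> = T + B\<close> with the model operator \<open>T\<close> and the multiplication \<open>B\<close> by \<open>2 - 2u - \<mu>\<close>. The potential
  \<open>P = 1 - t (2 - 2u - \<mu>)\<close> of \<open>T + t B\<close> satisfies \<open>Re P \<ge> 2u - 1\<close> for all \<open>0 \<le> t \<le> 1\<close>, because \<open>u \<le> 1\<close> and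
  \<open>Re \<mu> \<ge> 0\<close>; this is the only place where the sign of \<open>Re \<mu>\<close> enters.
\<close>

lemma resolvent_bound_and_surj:
  assumes c: "0 \<le> c" and sp: "spreading_profile c u" and \<mu>: "Re \<mu> \<ge> 0"
  obtains K where "\<And>p. p \<in> dom_L \<Longrightarrow> norm p \<le> K * norm (shifted (op_L c u) \<mu> p)"
    "\<And>g. \<exists>p\<in>dom_L. shifted (op_L c u) \<mu> p = g"
    "\<And>p q. p \<in> dom_L \<Longrightarrow> q \<in> dom_L \<Longrightarrow> p - q \<in> dom_L \<and>
      shifted (op_L c u) \<mu> (p - q) = shifted (op_L c u) \<mu> p - shifted (op_L c u) \<mu> q"
proof -
  define T where "T p = wderiv (wderiv p) + c *\<^sub>R wderiv p - p" for p
  define B where "B p = mult_l2 (\<lambda>z. 1 - 2 * u z) p + p - \<mu> *\<^sub>C p" for p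
  have TB: "shifted (op_L c u) \<mu> p = T p + B p" for p
    by (simp add: shifted_def op_L_def T_def B_def)
  have u: "0 \<le> u z" "u z < 1" if "z \<le> 0" for z
    using sp that by (auto simp: spreading_profile_def image_subset_iff)
  have um: "(\<lambda>z. 1 - 2 * u z) \<in> borel_measurable halfline"
    by (rule halfline_measurable) (intro continuous_intros profile_continuous[OF sp])
  have Brep: "AE z in halfline. rep_l2 (B p) z = (of_real (2 - 2 * u z) - \<mu>) * rep_l2 p z" for p
  proof -
    have "AE z in halfline. rep_l2 (mult_l2 (\<lambda>z. 1 - 2 * u z) p) z = of_real (1 - 2 * u z) * rep_l2 p z"
    proof (rule rep_mult_l2[OF um])
      show "\<bar>1 - 2 * u z\<bar> \<le> 1" if "z < 0" for z using u[of z] that by (simp add: abs_le_iff)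
    qed
    then show ?thesis
      unfolding B_def
      using AE_rep_diff[of "mult_l2 (\<lambda>z. 1 - 2 * u z) p + p" "\<mu> *\<^sub>C p"]
        AE_rep_plus[of "mult_l2 (\<lambda>z. 1 - 2 * u z) p" p] AE_rep_scaleC[of \<mu> p]
    proof eventually_elim
      case (elim z)
      show ?case unfolding elim(2) elim(3) elim(4) elim(1) by (simp add: algebra_simps)
    qed
  qed
  have Bdiff: "B (p - q) = B p - B q" for p q
    unfolding l2_eq_iff
    using Brep[of "p - q"] Brep[of p] Brep[of q] AE_rep_diff[of p q] AE_rep_diff[of "B p" "B q"]
  proof eventually_elim
    case (elim z)
    show ?case unfolding elim(1) elim(4) elim(5) elim(2) elim(3) by (simp add: algebra_simps)
  qed
  have Bnorm: "norm (B p) \<le> (2 + cmod \<mu>) * norm p" for p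
  proof (rule norm_l2_le)
    have "AE z in halfline. z < 0" by (rule AE_I2) simp
    then show "AE z in halfline. cmod (rep_l2 (B p) z) \<le> (2 + cmod \<mu>) * cmod (rep_l2 p z)"
      using Brep[of p]
    proof eventually_elim
      case (elim z)
      have "cmod (of_real (2 - 2 * u z) - \<mu>) \<le> \<bar>2 - 2 * u z\<bar> + cmod \<mu>"
        using norm_triangle_ineq4[of "of_real (2 - 2 * u z)" \<mu>] by (simp only: norm_of_real)
      also have "\<dots> \<le> 2 + cmod \<mu>" using u[of z] elim(1) by auto
      finally show ?case using elim(2) by (simp add: norm_mult mult_right_mono)
    qed
  qed simp
  have Tdiff: "T (p - q) = T p - T q" if "p \<in> dom_L" "q \<in> dom_L" for p q
    unfolding T_def
    by (subst dom_L_diff(3)[OF that], subst dom_L_diff(2)[OF that]) (simp add: algebra_simps)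
  obtain K where K0: "K \<ge> 0" and K: "\<forall>f g r P h. primitive f g \<longrightarrow> primitive g r \<longrightarrow> f 0 = 0 \<longrightarrow>
      square_int f \<longrightarrow> square_int g \<longrightarrow> square_int h \<longrightarrow>
      (\<forall>z\<le>0. 2 * u z - 1 \<le> Re (P z)) \<longrightarrow>
      (AE z in halfline. r z = h z - c *\<^sub>R g z + P z * f z) \<longrightarrow>
      integral {..0} (\<lambda>z. (cmod (f z))\<^sup>2) \<le> K\<^sup>2 * integral {..0} (\<lambda>z. (cmod (h z))\<^sup>2)"
    using energy_estimate[OF c sp] by blast
  have apriori: "norm p \<le> K * norm (T p + t *\<^sub>R B p)" if t: "0 \<le> t" "t \<le> 1" and p: "p \<in> dom_L" for t p
  proof -
    obtain f g where f: "primitive f g" and g: "primitive g (rep_l2 (wderiv (wderiv p)))"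
      and fp: "AE z in halfline. rep_l2 p z = f z" and gp: "AE z in halfline. rep_l2 (wderiv p) z = g z"
      and f0: "f 0 = 0" and sf: "square_int f" and sg: "square_int g"
      using dom_L_representatives[OF p] .
    let ?h = "rep_l2 (T p + t *\<^sub>R B p)"
    define P where "P z = 1 - of_real t * (of_real (2 - 2 * u z) - \<mu>)" for z
    have "integral {..0} (\<lambda>z. (cmod (f z))\<^sup>2) \<le> K\<^sup>2 * integral {..0} (\<lambda>z. (cmod (?h z))\<^sup>2)"
    proof (rule K[rule_format, OF f g f0 sf sg square_int_rep])
      show "2 * u z - 1 \<le> Re (P z)" if "z \<le> 0" for z
      proof -
        have "t * (2 - 2 * u z) \<le> 1 * (2 - 2 * u z)" using t u[OF that] by (intro mult_right_mono) auto
        moreover have "0 \<le> t * Re \<mu>" using t \<mu> by simp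
        ultimately show ?thesis by (simp add: P_def algebra_simps)
      qed
      show "AE z in halfline. rep_l2 (wderiv (wderiv p)) z = ?h z - c *\<^sub>R g z + P z * f z"
        using AE_rep_plus[of "T p" "t *\<^sub>R B p"] AE_rep_scaleR[of t "B p"] Brep[of p] fp gp
          AE_rep_diff[of "wderiv (wderiv p) + c *\<^sub>R wderiv p" p, folded T_def]
          AE_rep_plus[of "wderiv (wderiv p)" "c *\<^sub>R wderiv p"] AE_rep_scaleR[of c "wderiv p"]
      proof eventually_elim
        case (elim z)
        show ?case
          unfolding elim(1) elim(2) elim(3) elim(6) elim(7) elim(8) elim(4) elim(5)
          by (simp add: P_def algebra_simps scaleR_conv_of_real)
      qed
    qed
    moreover have "integral {..0} (\<lambda>z. (cmod (f z))\<^sup>2) = (norm p)\<^sup>2"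
      unfolding norm_l2_square[OF sf fp]
      by (rule halfline_integral_eq[symmetric]) (use sf in \<open>simp add: square_int_def\<close>)
    moreover have "integral {..0} (\<lambda>z. (cmod (?h z))\<^sup>2) = (norm (T p + t *\<^sub>R B p))\<^sup>2"
      using norm_l2_square[OF square_int_rep, of "T p + t *\<^sub>R B p" "T p + t *\<^sub>R B p"]
        halfline_integral_eq[of "\<lambda>z. (cmod (?h z))\<^sup>2"] square_int_rep[of "T p + t *\<^sub>R B p"]
      by (simp add: square_int_def)
    ultimately have "(norm p)\<^sup>2 \<le> (K * norm (T p + t *\<^sub>R B p))\<^sup>2" by (simp add: power_mult_distrib)
    then show ?thesis by (rule power2_le_imp_le) (use K0 in simp)
  qed
  show ?thesis
  proof (rule that[of K])
    show "norm p \<le> K * norm (shifted (op_L c u) \<mu> p)" if "p \<in> dom_L" for p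
      using apriori[of 1 p] that by (simp add: TB)
    show "\<exists>p\<in>dom_L. shifted (op_L c u) \<mu> p = g" for g
      unfolding TB
      by (rule method_of_continuity[OF complete_l2 dom_L_diff(1) Tdiff Bdiff Bnorm apriori])
        (auto simp: T_def intro: model_operator_surj)
    show "p - q \<in> dom_L \<and> shifted (op_L c u) \<mu> (p - q) = shifted (op_L c u) \<mu> p - shifted (op_L c u) \<mu> q"
      if "p \<in> dom_L" "q \<in> dom_L" for p q
      using dom_L_diff(1)[OF that] Tdiff[OF that] Bdiff[of p q] by (simp add: TB)
  qed
qed

lemma fredholm_invertible_if_bijective:
  assumes K: "\<And>p. p \<in> D \<Longrightarrow> norm p \<le> K * norm (A p)" and surj: "\<And>g. \<exists>p\<in>D. A p = g"
    and diff: "\<And>p q. p \<in> D \<Longrightarrow> q \<in> D \<Longrightarrow> p - q \<in> D \<and> A (p - q) = A p - A q"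
  shows "fredholm D A" "fredholm_index D A = 0" "invertible_op D A"
proof -
  have "g \<in> A ` D" for g using surj[of g] by auto
  then have range: "A ` D = UNIV" by auto
  have ker: "ker_on D A = {0}"
  proof -
    have zero: "p = 0" if "p \<in> D" "A p = 0" for p using K[OF that(1)] that(2) by simp
    obtain p where "p \<in> D" "A p = 0" using surj by blast
    then show ?thesis using zero unfolding ker_on_def by blast
  qed
  have span: "cvs.span (UNIV \<union> {}) = UNIV" using cvs.span_superset by blast
  have "finite_dim {0}" unfolding finite_dim_def using cvs.span_zero by (intro exI[of _ "{}"]) auto
  moreover have "finite_codim UNIV" unfolding finite_codim_def using span by blast
  ultimately show "fredholm D A" by (simp add: fredholm_def ker range)
  have "codim UNIV = 0"
    unfolding codim_def by (rule Least_eq_0) (use span in \<open>auto intro!: exI[of _ "{}"]\<close>)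
  moreover have "cvs.dim {0} = 0" by (rule cvs.dim_unique[of "{}"]) (auto simp: cvs.independent_empty)
  ultimately show "fredholm_index D A = 0" by (simp add: fredholm_index_def ker range)
  have inj: "inj_on A D"
  proof (rule inj_onI)
    fix p q assume "p \<in> D" "q \<in> D" "A p = A q"
    then have "norm (p - q) \<le> K * 0" using K[of "p - q"] diff[of p q] by simp
    then show "p = q" by simp
  qed
  show "invertible_op D A"
    unfolding invertible_op_def
  proof (intro conjI exI[of _ K] allI)
    show "bij_betw A D UNIV" using inj range by (simp add: bij_betw_def)
    show "norm (inv_into D A g) \<le> K * norm g" for g
      using K[OF inv_into_into[of g A D]] f_inv_into_f[of g A D] range by simp
  qed
qed

theorem mainTheorem1:
  fixes c :: real and u :: "real \<Rightarrow> real"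
  assumes "0 \<le> c" and "c < 2"
    and "spreading_profile c u"
  shows "essential_spectrum dom_L (op_L c u) \<subseteq> {\<mu>. Re \<mu> < 0} \<and>
         point_spectrum dom_L (op_L c u) \<inter> {\<mu>. Re \<mu> \<ge> 0} = {}"
proof -
  have "fredholm dom_L (shifted (op_L c u) \<mu>) \<and> fredholm_index dom_L (shifted (op_L c u) \<mu>) = 0 \<and>
      invertible_op dom_L (shifted (op_L c u) \<mu>)" if \<mu>: "Re \<mu> \<ge> 0" for \<mu>
  proof -
    obtain K where K: "\<And>p. p \<in> dom_L \<Longrightarrow> norm p \<le> K * norm (shifted (op_L c u) \<mu> p)"
      "\<And>g. \<exists>p\<in>dom_L. shifted (op_L c u) \<mu> p = g"
      "\<And>p q. p \<in> dom_L \<Longrightarrow> q \<in> dom_L \<Longrightarrow> p - q \<in> dom_L \<and>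
        shifted (op_L c u) \<mu> (p - q) = shifted (op_L c u) \<mu> p - shifted (op_L c u) \<mu> q"
      by (rule resolvent_bound_and_surj[OF assms(1,3) \<mu>]) (rule that)
    show ?thesis using fredholm_invertible_if_bijective[OF K] by blast
  qed
  moreover have "Re \<mu> < 0 \<or> 0 \<le> Re \<mu>" for \<mu> by linarith
  ultimately show ?thesis
    unfolding essential_spectrum_def point_spectrum_def by blast
qed

end
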